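(* Let $H$ be a real Hilbert space and let $A$ be a linear operator on $H$ that is unitarily equivalent to a non-negative multiplication operator (in the sense specified in the context). Let $t_0$ be a positive real number, and let $b:[t_0,+\infty)\to\mathbb{R}$ be a measurable function. Assume that there exist two real numbers $M\geq m>0$ such that $$\frac{m}{t}\leq b(t)\leq\frac{M}{t}\qquad\forall t\geq t_0,$$ and set $\mu:=\min\{m,2\}$. Then for every $u_0\in D(A^{1/2})$ and every $u_1\in H$, the solution $u$ to the problem $$u''(t)+b(t)u'(t)+Au(t)=0\quad (t\geq t_0),\qquad u(t_0)=u_0,\quad u'(t_0)=u_1,$$ satisfies $$|u'(t)|^2+|A^{1/2}u(t)|^2\leq e^{m(M+8)}\left(4|u_1|^2+|A^{1/2}u_0|^2+\frac{2}{t_0^2}|u_0|^2\right)\left(\frac{t_0}{t}\right)^{\mu}\qquad\forall t\geq t_0.$$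
   Context: Functional setting. $H$ is a real Hilbert space with norm $|\cdot|$, and $A$ is a linear operator on $H$ with domain $D(A)$, unitarily equivalent to a non-negative multiplication operator: there exist a measure space $(\mathcal{M},\nu)$, a measurable function $\lambda:\mathcal{M}\to[0,+\infty)$ and a surjective linear isometry $\mathscr{F}:H\to L^2(\mathcal{M},\nu)$ (real-valued functions) such that $u\in D(A)$ if and only if $\lambda(\xi)^2[\mathscr{F}u](\xi)\in L^2(\mathcal{M},\nu)$, and $[\mathscr{F}(Au)](\xi)=\lambda(\xi)^2[\mathscr{F}u](\xi)$ for every $u\in D(A)$. Writing $\widehat{u}=\mathscr{F}u$, for $\beta>0$ the space $D(A^{\beta})$ is the set of $u\in H$ with $\int_{\mathcal{M}}\lambda(\xi)^{4\beta}\widehat{u}(\xi)^2\,d\nu(\xi)<+\infty$, and for such $u$ one has $|A^{\beta}u|^2=\int_{\mathcal{M}}\lambda(\xi)^{4\beta}\widehat{u}(\xi)^2\,d\nu(\xi)$. Solutions. If $b\in L^1((t_0,T))$ for every $T>t_0$, the solution of $u''+b(t)u'+Au=0$ with $u(t_0)=u_0\in D(A^{1/2})$, $u'(t_0)=u_1\in H$ is defined as $u(t):=\mathscr{F}^{-1}\widehat{u}(t,\cdot)$, where for each $\xi\in\mathcal{M}$ the function $t\mapsto\widehat{u}(t,\xi)$ solves the ordinary differential equation $\widehat{u}\,''(t,\xi)+b(t)\widehat{u}\,'(t,\xi)+\lambda(\xi)^2\widehat{u}(t,\xi)=0$ (primes are time derivatives; the function is $C^1$ in $t$ with locally absolutely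 continuous derivative, and the equation holds for almost every $t$), with $\widehat{u}(t_0,\xi)=[\mathscr{F}u_0](\xi)$ and $\widehat{u}\,'(t_0,\xi)=[\mathscr{F}u_1](\xi)$. This is the unique solution in $C^0([t_0,+\infty),D(A^{1/2}))\cap C^1([t_0,+\infty),H)$. *)

theory Defs
  imports "HOL-Analysis.Analysis"
begin

text \<open>Square integrable real functions on a measure space. The Hilbert space \<open>L\<^sup>2\<close> is the
  quotient of this set by equality almost everywhere; below, its elements are handled through
  representatives.\<close>

definition square_integrable :: "'x measure \<Rightarrow> ('x \<Rightarrow> real) set" where
  "square_integrable \<nu> = {f \<in> borel_measurable \<nu>. integrable \<nu> (\<lambda>\<xi>. (f \<xi>)\<^sup>2)}"

text \<open>A surjective linear isometry \<open>H \<rightarrow> L\<^sup>2(\<nu>)\<close>: \<open>F u\<close> is a representative of the image of \<open>u\<close>, so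
  linearity and surjectivity are understood up to null sets.\<close>

definition L2_isometry :: "'x measure \<Rightarrow> ('h::{real_inner,complete_space} \<Rightarrow> 'x \<Rightarrow> real) \<Rightarrow> bool" where
  "L2_isometry \<nu> F \<longleftrightarrow>
     (\<forall>u. F u \<in> square_integrable \<nu>) \<and>
     (\<forall>u v. AE \<xi> in \<nu>. F (u + v) \<xi> = F u \<xi> + F v \<xi>) \<and>
     (\<forall>c u. AE \<xi> in \<nu>. F (c *\<^sub>R u) \<xi> = c * F u \<xi>) \<and>
     (\<forall>u. (LINT \<xi>|\<nu>. (F u \<xi>)\<^sup>2) = (norm u)\<^sup>2) \<and>
     (\<forall>g\<in>square_integrable \<nu>. \<exists>u. AE \<xi> in \<nu>. F u \<xi> = g \<xi>)"

definition linear_operator :: "'h::real_vector set \<Rightarrow> ('h \<Rightarrow> 'h) \<Rightarrow> bool" where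
  "linear_operator D A \<longleftrightarrow>
     subspace D \<and>
     (\<forall>u\<in>D. \<forall>v\<in>D. A (u + v) = A u + A v) \<and>
     (\<forall>c. \<forall>u\<in>D. A (c *\<^sub>R u) = c *\<^sub>R A u)"

text \<open>The operator \<open>A\<close> with domain \<open>D\<close> is conjugated by \<open>F\<close> to multiplication by \<open>\<lambda>\<^sup>2\<close>
  (\<open>l\<close> stands for \<open>\<lambda>\<close>).\<close>

definition unitarily_multiplication ::
  "'x measure \<Rightarrow> ('x \<Rightarrow> real) \<Rightarrow> ('h::{real_inner,complete_space} \<Rightarrow> 'x \<Rightarrow> real) \<Rightarrow>
   'h set \<Rightarrow> ('h \<Rightarrow> 'h) \<Rightarrow> bool" where
  "unitarily_multiplication \<nu> l F D A \<longleftrightarrow>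
     linear_operator D A \<and>
     l \<in> borel_measurable \<nu> \<and> (\<forall>\<xi>\<in>space \<nu>. 0 \<le> l \<xi>) \<and>
     L2_isometry \<nu> F \<and>
     (\<forall>u. u \<in> D \<longleftrightarrow> (\<lambda>\<xi>. (l \<xi>)\<^sup>2 * F u \<xi>) \<in> square_integrable \<nu>) \<and>
     (\<forall>u\<in>D. AE \<xi> in \<nu>. F (A u) \<xi> = (l \<xi>)\<^sup>2 * F u \<xi>)"

text \<open>The domain of \<open>A\<^sup>\<beta>\<close> and the operator \<open>A\<^sup>\<beta>\<close> itself, for \<open>\<beta> > 0\<close>. Note that
  \<open>0 powr a = 0\<close>, also the correct value of \<open>\<lambda>\<^sup>a\<close> at \<open>\<lambda> = 0\<close> when \<open>a > 0\<close>.\<close>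

definition power_domain ::
  "'x measure \<Rightarrow> ('x \<Rightarrow> real) \<Rightarrow> ('h \<Rightarrow> 'x \<Rightarrow> real) \<Rightarrow> real \<Rightarrow> 'h set" where
  "power_domain \<nu> l F \<beta> =
     {u. (\<integral>\<^sup>+ \<xi>. ennreal (l \<xi> powr (4 * \<beta>) * (F u \<xi>)\<^sup>2) \<partial>\<nu>) < \<infinity>}"

definition power_operator ::
  "'x measure \<Rightarrow> ('x \<Rightarrow> real) \<Rightarrow> ('h \<Rightarrow> 'x \<Rightarrow> real) \<Rightarrow> real \<Rightarrow> 'h \<Rightarrow> 'h" where
  "power_operator \<nu> l F \<beta> u =
     (THE v. AE \<xi> in \<nu>. F v \<xi> = l \<xi> powr (2 * \<beta>) * F u \<xi>)"

lemma L2_isometry_inject: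
  assumes F: "L2_isometry \<nu> F" and vw: "AE \<xi> in \<nu>. F v \<xi> = F w \<xi>"
  shows "v = w"
proof -
  have "AE \<xi> in \<nu>. F (v + (-1) *\<^sub>R w) \<xi> = F v \<xi> + F ((-1) *\<^sub>R w) \<xi>"
       "AE \<xi> in \<nu>. F ((-1) *\<^sub>R w) \<xi> = (-1) * F w \<xi>"
    using F unfolding L2_isometry_def by blast+
  with vw have "AE \<xi> in \<nu>. (F (v + (-1) *\<^sub>R w) \<xi>)\<^sup>2 = 0"
    by eventually_elim simp
  then have "(LINT \<xi>|\<nu>. (F (v + (-1) *\<^sub>R w) \<xi>)\<^sup>2) = 0"
    by (rule integral_eq_zero_AE)
  then have "(norm (v + (-1) *\<^sub>R w))\<^sup>2 = 0"
    using F unfolding L2_isometry_def by metis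
  then show ?thesis by simp
qed

lemma power_operator_unique:
  assumes "L2_isometry \<nu> F" and "AE \<xi> in \<nu>. F v \<xi> = l \<xi> powr (2 * \<beta>) * F u \<xi>"
  shows "power_operator \<nu> l F \<beta> u = v"
  unfolding power_operator_def
proof (rule the_equality)
  fix w assume "AE \<xi> in \<nu>. F w \<xi> = l \<xi> powr (2 * \<beta>) * F u \<xi>"
  with assms(2) have "AE \<xi> in \<nu>. F w \<xi> = F v \<xi>" by eventually_elim simp
  then show "w = v" using L2_isometry_inject[OF assms(1)] by blast
qed fact

lemma power_operator_spectral:
  assumes F: "L2_isometry \<nu> F" and l: "l \<in> borel_measurable \<nu>"
    and u: "u \<in> power_domain \<nu> l F \<beta>"
  shows "AE \<xi> in \<nu>. F (power_operator \<nu> l F \<beta> u) \<xi> = l \<xi> powr (2 * \<beta>) * F u \<xi>"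
    and "(norm (power_operator \<nu> l F \<beta> u))\<^sup>2 = (LINT \<xi>|\<nu>. l \<xi> powr (4 * \<beta>) * (F u \<xi>)\<^sup>2)"
proof -
  have sq: "(l \<xi> powr (2 * \<beta>) * F u \<xi>)\<^sup>2 = l \<xi> powr (4 * \<beta>) * (F u \<xi>)\<^sup>2" for \<xi>
    by (simp add: power2_eq_square powr_add[symmetric] mult.assoc mult.left_commute)
  have Fu: "F u \<in> borel_measurable \<nu>"
    using F by (auto simp: L2_isometry_def square_integrable_def)
  have "integrable \<nu> (\<lambda>\<xi>. l \<xi> powr (4 * \<beta>) * (F u \<xi>)\<^sup>2)"
    using u Fu l by (intro integrableI_nonneg) (auto simp: power_domain_def)
  then have "(\<lambda>\<xi>. l \<xi> powr (2 * \<beta>) * F u \<xi>) \<in> square_integrable \<nu>"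
    using Fu l by (auto simp: square_integrable_def sq)
  moreover have "\<forall>g\<in>square_integrable \<nu>. \<exists>u. AE \<xi> in \<nu>. F u \<xi> = g \<xi>"
    using F by (simp add: L2_isometry_def)
  ultimately have "\<exists>v. AE \<xi> in \<nu>. F v \<xi> = l \<xi> powr (2 * \<beta>) * F u \<xi>"
    by (rule bspec[rotated])
  then obtain v where v: "AE \<xi> in \<nu>. F v \<xi> = l \<xi> powr (2 * \<beta>) * F u \<xi>" ..
  have eq: "power_operator \<nu> l F \<beta> u = v" by (rule power_operator_unique[OF F v])
  show "AE \<xi> in \<nu>. F (power_operator \<nu> l F \<beta> u) \<xi> = l \<xi> powr (2 * \<beta>) * F u \<xi>"
    using v eq by simp
  have "(LINT \<xi>|\<nu>. (F v \<xi>)\<^sup>2) = (LINT \<xi>|\<nu>. l \<xi> powr (4 * \<beta>) * (F u \<xi>)\<^sup>2)"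
  proof (rule integral_cong_AE)
    show "(\<lambda>\<xi>. (F v \<xi>)\<^sup>2) \<in> borel_measurable \<nu>"
      using F by (auto simp: L2_isometry_def square_integrable_def)
    show "(\<lambda>\<xi>. l \<xi> powr (4 * \<beta>) * (F u \<xi>)\<^sup>2) \<in> borel_measurable \<nu>"
      using Fu l by measurable
    show "AE \<xi> in \<nu>. (F v \<xi>)\<^sup>2 = l \<xi> powr (4 * \<beta>) * (F u \<xi>)\<^sup>2"
      using v by eventually_elim (simp only: sq)
  qed
  then show "(norm (power_operator \<nu> l F \<beta> u))\<^sup>2
      = (LINT \<xi>|\<nu>. l \<xi> powr (4 * \<beta>) * (F u \<xi>)\<^sup>2)"
    using F eq by (simp add: L2_isometry_def)
qed

text \<open>Absolute continuity of a real function on an interval \<open>S\<close>: finite families of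
  non-overlapping subintervals \<open>[a,b]\<close> of small total length have small total
  variation \<open>\<Sum>\<bar>f b - f a\<bar>\<close>.\<close>

definition abs_continuous_on :: "real set \<Rightarrow> (real \<Rightarrow> real) \<Rightarrow> bool" where
  "abs_continuous_on S f \<longleftrightarrow>
     (\<forall>\<epsilon>>0. \<exists>\<delta>>0. \<forall>d. d division_of \<Union>d \<and> \<Union>d \<subseteq> S \<and> (\<Sum>k\<in>d. Sup k - Inf k) < \<delta> \<longrightarrow>
        (\<Sum>k\<in>d. \<bar>f (Sup k) - f (Inf k)\<bar>) < \<epsilon>)"

text \<open>Solutions on \<open>[t\<^sub>0,\<infinity>)\<close> of \<open>y'' + b(t) y' + c\<^sup>2 y = 0\<close>, \<open>y(t\<^sub>0) = y\<^sub>0\<close>, \<open>y'(t\<^sub>0) = y\<^sub>1\<close>; here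
  \<open>y'\<close> is the first derivative. Derivatives at \<open>t\<^sub>0\<close> are one-sided.\<close>

definition scalar_solution ::
  "real \<Rightarrow> (real \<Rightarrow> real) \<Rightarrow> real \<Rightarrow> real \<Rightarrow> real \<Rightarrow> (real \<Rightarrow> real) \<Rightarrow> bool" where
  "scalar_solution t0 b c y0 y1 y \<longleftrightarrow>
     (\<exists>y'. (\<forall>t\<ge>t0. (y has_real_derivative y' t) (at t within {t0..})) \<and>
           continuous_on {t0..} y' \<and>
           (\<forall>T>t0. abs_continuous_on {t0..T} y') \<and>
           (AE t in lebesgue. t0 \<le> t \<longrightarrow>
              (\<exists>y''. (y' has_real_derivative y'') (at t within {t0..}) \<and>
                     y'' + b t * y' t + c\<^sup>2 * y t = 0)) \<and>
           y t0 = y0 \<and> y' t0 = y1)"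

text \<open>\<open>u\<close> is the solution of \<open>u'' + b(t) u' + A u = 0\<close>, \<open>u(t\<^sub>0) = u\<^sub>0\<close>, \<open>u'(t\<^sub>0) = u\<^sub>1\<close> on \<open>[t\<^sub>0,\<infinity>)\<close>,
  defined frequency by frequency: \<open>u(t)\<close> is the preimage under \<open>F\<close> of \<open>w t\<close>, where \<open>w t \<xi>\<close> solves
  for each \<open>\<xi>\<close> the scalar equation with \<open>c = \<lambda>(\<xi>)\<close>.\<close>

definition spectral_solution ::
  "'x measure \<Rightarrow> ('x \<Rightarrow> real) \<Rightarrow> ('h \<Rightarrow> 'x \<Rightarrow> real) \<Rightarrow>
   real \<Rightarrow> (real \<Rightarrow> real) \<Rightarrow> 'h \<Rightarrow> 'h \<Rightarrow> (real \<Rightarrow> 'h) \<Rightarrow> bool" where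
  "spectral_solution \<nu> l F t0 b u0 u1 u \<longleftrightarrow>
     (\<exists>w. (\<forall>\<xi>\<in>space \<nu>. scalar_solution t0 b (l \<xi>) (F u0 \<xi>) (F u1 \<xi>) (\<lambda>t. w t \<xi>)) \<and>
          (\<forall>t\<ge>t0. AE \<xi> in \<nu>. F (u t) \<xi> = w t \<xi>))"

end

theory Submission
  imports Defs
begin

text \<open>
  The spectral representation decouples the equation into the damped oscillators
  \<open>y'' + b(t) y' + c\<^sup>2 y = 0\<close> with \<open>c = l \<xi>\<close>. The whole estimate follows, by integration over \<open>\<xi>\<close>, from
  the same estimate for a single oscillator with constants independent of \<open>c\<close>
  (\<open>energy_decay\<close>). What remains is to see that \<open>u\<close> is differentiable in the Hilbert space with the
  expected derivative; this is dominated convergence, where the scalar estimate provides the bound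
  (\<open>L2_isometry_has_vector_derivative\<close>).

  A single oscillator passes through two regimes. As long as \<open>c * t\<close> is bounded, the restoring force
  hardly matters (the inertial regime): \<open>y'\<close> decays by damping alone, and the potential energy is small because
  \<open>c \<le> const / t\<close>. If \<open>y\<close> stays nearly constant, the potential energy at the end of this regime is of
  order \<open>1 / t\<^sup>2\<close>, and no better: hence the bound \<open>2\<close> in \<open>min m 2\<close>, and the term \<open>2 / t0\<^sup>2 * (norm u0)\<^sup>2\<close>, since at low
  frequencies the position at time \<open>t0\<close> feeds a later energy that its initial potential energy times
  \<open>(t0 / t) powr \<mu>\<close> does not bound. Two functionals give the
  decay there: \<open>y'\<^sup>2 + c\<^sup>2 y\<^sup>2 + m (2 - m) y\<^sup>2 / t\<^sup>2\<close> for \<open>m \<le> 1\<close>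
  (\<open>energy_bound_inertial_small_damping\<close>), and \<open>\<bar>y\<bar> + (2 / \<mu>) t \<bar>y'\<bar>\<close> for \<open>m \<ge> 1\<close>
  (\<open>energy_bound_inertial_general\<close>). Once \<open>c * t\<close> is bounded below, the oscillation equalizes kinetic and
  potential energy on average, and \<open>y'\<^sup>2 + c\<^sup>2 y\<^sup>2 + (\<mu> / t) y y'\<close> decays like \<open>t powr (- \<mu>)\<close>
  up to integrable errors (\<open>energy_decay_oscillating\<close>).

  The damping \<open>b\<close> is merely measurable, so \<open>y'\<close> is only absolutely continuous and the equation holds
  almost everywhere. The functionals inherit absolute continuity, and for absolutely continuous
  functions a differential inequality almost everywhere can be integrated
  (\<open>gronwall_abs_continuous\<close>).
\<close>

section \<open>Absolutely continuous functions\<close>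

lemma abs_continuous_onE:
  assumes "abs_continuous_on S f" "\<epsilon> > 0"
  obtains \<delta> where "\<delta> > 0"
    "\<And>d. d division_of \<Union>d \<Longrightarrow> \<Union>d \<subseteq> S \<Longrightarrow> (\<Sum>k\<in>d. Sup k - Inf k) < \<delta> \<Longrightarrow>
       (\<Sum>k\<in>d. \<bar>f (Sup k) - f (Inf k)\<bar>) < \<epsilon>"
  using assms unfolding abs_continuous_on_def by meson

lemma abs_continuous_on_subset:
  "abs_continuous_on T f \<Longrightarrow> S \<subseteq> T \<Longrightarrow> abs_continuous_on S f"
  unfolding abs_continuous_on_def by (meson order_trans)

lemma division_of_real_memberD:
  fixes d :: "real set set"
  assumes "d division_of \<Union>d" "k \<in> d"
  shows "Inf k \<le> Sup k" "Inf k \<in> k" "Sup k \<in> k" "k = {Inf k..Sup k}"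
proof -
  obtain a b where k: "k = cbox a b" and ne: "k \<noteq> {}"
    using division_ofD(3,4)[OF assms] by blast
  then have "a \<le> b" by auto
  with k show "Inf k \<le> Sup k" "Inf k \<in> k" "Sup k \<in> k" "k = {Inf k..Sup k}"
    by auto
qed

text \<open>Sums, products and absolute values of absolutely continuous functions all have increments
  dominated by those of the given functions, so one comparison lemma yields all these closure
  properties.\<close>

lemma abs_continuous_on_increments:
  assumes g: "abs_continuous_on S g" and h: "abs_continuous_on S h" and L: "L \<ge> 0"
    and le: "\<And>u v. u \<in> S \<Longrightarrow> v \<in> S \<Longrightarrow> u \<le> v \<Longrightarrow> \<bar>f v - f u\<bar> \<le> L * (\<bar>g v - g u\<bar> + \<bar>h v - h u\<bar>)"
  shows "abs_continuous_on S f"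
  unfolding abs_continuous_on_def
proof (intro allI impI)
  fix \<epsilon> :: real assume "\<epsilon> > 0"
  \<comment> \<open>Half of \<open>\<epsilon>\<close> for each of \<open>g\<close> and \<open>h\<close>; \<open>L + 1\<close> instead of \<open>L\<close> covers \<open>L = 0\<close>.\<close>
  define \<eta> where "\<eta> = \<epsilon> / (2 * (L + 1))"
  have \<eta>: "\<eta> > 0" using \<open>\<epsilon> > 0\<close> L by (simp add: \<eta>_def)
  obtain \<delta>1 where \<delta>1: "\<delta>1 > 0" "\<And>d. d division_of \<Union>d \<Longrightarrow> \<Union>d \<subseteq> S \<Longrightarrow> (\<Sum>k\<in>d. Sup k - Inf k) < \<delta>1 \<Longrightarrow>
       (\<Sum>k\<in>d. \<bar>g (Sup k) - g (Inf k)\<bar>) < \<eta>"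
    using abs_continuous_onE[OF g \<eta>] by blast
  obtain \<delta>2 where \<delta>2: "\<delta>2 > 0" "\<And>d. d division_of \<Union>d \<Longrightarrow> \<Union>d \<subseteq> S \<Longrightarrow> (\<Sum>k\<in>d. Sup k - Inf k) < \<delta>2 \<Longrightarrow>
       (\<Sum>k\<in>d. \<bar>h (Sup k) - h (Inf k)\<bar>) < \<eta>"
    using abs_continuous_onE[OF h \<eta>] by blast
  show "\<exists>\<delta>>0. \<forall>d. d division_of \<Union>d \<and> \<Union>d \<subseteq> S \<and> (\<Sum>k\<in>d. Sup k - Inf k) < \<delta> \<longrightarrow>
        (\<Sum>k\<in>d. \<bar>f (Sup k) - f (Inf k)\<bar>) < \<epsilon>"
  proof (intro exI[of _ "min \<delta>1 \<delta>2"] conjI allI impI; (elim conjE)?)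
    fix d assume d: "d division_of \<Union>d" "\<Union>d \<subseteq> S" "(\<Sum>k\<in>d. Sup k - Inf k) < min \<delta>1 \<delta>2"
    have "(\<Sum>k\<in>d. \<bar>f (Sup k) - f (Inf k)\<bar>)
        \<le> (\<Sum>k\<in>d. L * (\<bar>g (Sup k) - g (Inf k)\<bar> + \<bar>h (Sup k) - h (Inf k)\<bar>))"
      using division_of_real_memberD[OF d(1)] d(2) by (intro sum_mono le) blast+
    also have "\<dots> = L * ((\<Sum>k\<in>d. \<bar>g (Sup k) - g (Inf k)\<bar>) + (\<Sum>k\<in>d. \<bar>h (Sup k) - h (Inf k)\<bar>))"
      by (simp only: sum_distrib_left[symmetric] sum.distrib)
    also have "\<dots> \<le> L * (\<eta> + \<eta>)"
      using \<delta>1(2)[OF d(1,2)] \<delta>2(2)[OF d(1,2)] d(3) L by (intro mult_left_mono) auto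
    also have "\<dots> < (L + 1) * (\<eta> + \<eta>)"
      using \<eta> by (simp add: algebra_simps)
    also have "\<dots> = \<epsilon>"
    proof -
      have "(L + 1) * (\<eta> + \<eta>) = 2 * (L + 1) * \<eta>" by (simp add: algebra_simps)
      then show ?thesis using L by (simp add: \<eta>_def)
    qed
    finally show "(\<Sum>k\<in>d. \<bar>f (Sup k) - f (Inf k)\<bar>) < \<epsilon>" .
  qed (use \<delta>1 \<delta>2 in simp)
qed

lemma abs_continuous_on_ident: "abs_continuous_on S (\<lambda>x. x)"
  unfolding abs_continuous_on_def
proof (intro allI impI)
  fix \<epsilon> :: real assume "\<epsilon> > 0"
  show "\<exists>\<delta>>0. \<forall>d. d division_of \<Union>d \<and> \<Union>d \<subseteq> S \<and> (\<Sum>k\<in>d. Sup k - Inf k) < \<delta> \<longrightarrow>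
        (\<Sum>k\<in>d. \<bar>Sup k - Inf k\<bar>) < \<epsilon>"
  proof (intro exI[of _ \<epsilon>] conjI allI impI; (elim conjE)?)
    fix d assume d: "d division_of \<Union>d" "(\<Sum>k\<in>d. Sup k - Inf k) < \<epsilon>"
    have "(\<Sum>k\<in>d. \<bar>Sup k - Inf k\<bar>) = (\<Sum>k\<in>d. Sup k - Inf k)"
      using division_of_real_memberD(1)[OF d(1)] by (intro sum.cong) auto
    with d show "(\<Sum>k\<in>d. \<bar>Sup k - Inf k\<bar>) < \<epsilon>" by simp
  qed fact
qed

lemma abs_continuous_on_imp_continuous_on:
  assumes "abs_continuous_on {a..b} f"
  shows "continuous_on {a..b} f"
  unfolding continuous_on_iff
proof (intro ballI allI impI)
  fix x \<epsilon> :: real assume x: "x \<in> {a..b}" and "\<epsilon> > 0"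
  obtain \<delta> where \<delta>: "\<delta> > 0" "\<And>d. d division_of \<Union>d \<Longrightarrow> \<Union>d \<subseteq> {a..b} \<Longrightarrow> (\<Sum>k\<in>d. Sup k - Inf k) < \<delta> \<Longrightarrow>
       (\<Sum>k\<in>d. \<bar>f (Sup k) - f (Inf k)\<bar>) < \<epsilon>"
    using abs_continuous_onE[OF assms \<open>\<epsilon> > 0\<close>] by blast
  have *: "\<bar>f v - f u\<bar> < \<epsilon>" if "u \<in> {a..b}" "v \<in> {a..b}" "u \<le> v" "v - u < \<delta>" for u v
    using \<delta>(2)[of "{cbox u v}"] division_of_self[of u v] that by auto
  show "\<exists>\<delta>>0. \<forall>x'\<in>{a..b}. dist x' x < \<delta> \<longrightarrow> dist (f x') (f x) < \<epsilon>"
  proof (intro exI[of _ \<delta>] conjI ballI impI)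
    fix x' assume "x' \<in> {a..b}" "dist x' x < \<delta>"
    then show "dist (f x') (f x) < \<epsilon>"
      using *[of x x'] *[of x' x] x by (cases "x \<le> x'") (auto simp: dist_real_def abs_minus_commute)
  qed fact
qed

lemma abs_continuous_on_add:
  assumes "abs_continuous_on S f" "abs_continuous_on S g"
  shows "abs_continuous_on S (\<lambda>x. f x + g x)"
  by (rule abs_continuous_on_increments[OF assms, of 1]) auto

lemma abs_continuous_on_abs:
  assumes "abs_continuous_on S f"
  shows "abs_continuous_on S (\<lambda>x. \<bar>f x\<bar>)"
proof (rule abs_continuous_on_increments[OF assms assms, of 1])
  fix u v
  show "\<bar>\<bar>f v\<bar> - \<bar>f u\<bar>\<bar> \<le> 1 * (\<bar>f v - f u\<bar> + \<bar>f v - f u\<bar>)"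
    using abs_triangle_ineq3[of "f v" "f u"] abs_ge_zero[of "f v - f u"] unfolding mult_1 by linarith
qed simp

lemma abs_continuous_on_mult:
  assumes f: "abs_continuous_on {a..b} f" and g: "abs_continuous_on {a..b} g"
  shows "abs_continuous_on {a..b} (\<lambda>x. f x * g x)"
proof -
  have "bounded (f ` {a..b})" "bounded (g ` {a..b})"
    using f g by (auto intro!: compact_imp_bounded compact_continuous_image abs_continuous_on_imp_continuous_on)
  then obtain B C where B: "\<And>x. x \<in> {a..b} \<Longrightarrow> \<bar>f x\<bar> \<le> B" and C: "\<And>x. x \<in> {a..b} \<Longrightarrow> \<bar>g x\<bar> \<le> C"
    unfolding bounded_iff by (metis imageI real_norm_def)
  show ?thesis
  proof (rule abs_continuous_on_increments[OF f g, of "max 0 (max B C)"])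
    fix u v assume uv: "u \<in> {a..b}" "v \<in> {a..b}"
    have "f v * g v - f u * g u = (f v - f u) * g v + f u * (g v - g u)"
      by (simp add: algebra_simps)
    then have "\<bar>f v * g v - f u * g u\<bar> \<le> \<bar>f v - f u\<bar> * \<bar>g v\<bar> + \<bar>f u\<bar> * \<bar>g v - g u\<bar>"
      by (metis abs_mult abs_triangle_ineq)
    also have "\<dots> \<le> \<bar>f v - f u\<bar> * max 0 (max B C) + max 0 (max B C) * \<bar>g v - g u\<bar>"
      using B[OF uv(1)] C[OF uv(2)] by (intro add_mono mult_left_mono mult_right_mono) auto
    finally show "\<bar>f v * g v - f u * g u\<bar> \<le> max 0 (max B C) * (\<bar>f v - f u\<bar> + \<bar>g v - g u\<bar>)"
      by (simp add: algebra_simps)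
  qed simp
qed

lemma abs_continuous_on_C1:
  assumes d: "\<And>x. x \<in> {a..b} \<Longrightarrow> (f has_real_derivative f' x) (at x within {a..b})"
    and c: "continuous_on {a..b} f'"
  shows "abs_continuous_on {a..b} f"
proof -
  have "bounded (f' ` {a..b})"
    using c by (auto intro!: compact_imp_bounded compact_continuous_image)
  then obtain B where B: "\<And>x. x \<in> {a..b} \<Longrightarrow> \<bar>f' x\<bar> \<le> B"
    unfolding bounded_iff by (metis imageI real_norm_def)
  show ?thesis
  proof (rule abs_continuous_on_increments[OF abs_continuous_on_ident abs_continuous_on_ident, of "max 0 B"])
    fix u v assume uv: "u \<in> {a..b}" "v \<in> {a..b}"
    have "\<bar>f v - f u\<bar> \<le> B * \<bar>v - u\<bar>"
      using field_differentiable_bound[OF convex_closed_interval[of a b] d, of B v u] B uv by auto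
    also have "\<dots> \<le> max 0 B * (\<bar>v - u\<bar> + \<bar>v - u\<bar>)"
      by (intro mult_mono) auto
    finally show "\<bar>f v - f u\<bar> \<le> max 0 B * (\<bar>v - u\<bar> + \<bar>v - u\<bar>)" .
  qed simp
qed

text \<open>The straddle lemma: the tag \<open>x\<close> of a fine tagged partition need only lie between the endpoints
  \<open>u\<close> and \<open>v\<close> for the difference quotient over \<open>[u,v]\<close> to be controlled by the derivative at \<open>x\<close>.\<close>

lemma has_real_derivative_straddle:
  fixes f :: "real \<Rightarrow> real"
  assumes "(f has_real_derivative D) (at x within S)" "\<epsilon> > 0"
  obtains \<delta> where "\<delta> > 0"
    "\<And>u v. u \<in> S \<Longrightarrow> v \<in> S \<Longrightarrow> u \<le> x \<Longrightarrow> x \<le> v \<Longrightarrow> \<bar>u - x\<bar> < \<delta> \<Longrightarrow> \<bar>v - x\<bar> < \<delta> \<Longrightarrow>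
       f v - f u \<le> (D + \<epsilon>) * (v - u)"
proof -
  from assms obtain \<delta> where \<delta>: "\<delta> > 0"
    "\<And>y. y \<in> S \<Longrightarrow> \<bar>y - x\<bar> < \<delta> \<Longrightarrow> \<bar>f y - f x - D * (y - x)\<bar> \<le> \<epsilon> * \<bar>y - x\<bar>"
    unfolding has_field_derivative_def has_derivative_within_alt by (metis real_norm_def)
  show thesis
  proof (rule that[OF \<delta>(1)])
    fix u v assume "u \<in> S" "v \<in> S" "u \<le> x" "x \<le> v" "\<bar>u - x\<bar> < \<delta>" "\<bar>v - x\<bar> < \<delta>"
    then have "\<bar>f u - f x - D * (u - x)\<bar> \<le> \<epsilon> * (x - u)" "\<bar>f v - f x - D * (v - x)\<bar> \<le> \<epsilon> * (v - x)"
      using \<delta>(2)[of u] \<delta>(2)[of v] by auto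
    then show "f v - f u \<le> (D + \<epsilon>) * (v - u)"
      by (simp add: algebra_simps abs_le_iff)
  qed
qed

text \<open>The sign of the derivative almost everywhere decides monotonicity, by a gauge argument. Let \<open>N\<close> be
  the exceptional null set, inside an open set \<open>U\<close> of small measure. Choose a gauge that forces intervals
  tagged in \<open>N\<close> to lie in \<open>U\<close>, and intervals tagged outside \<open>N\<close> to be so short that the straddle
  lemma bounds the increment by \<open>\<epsilon>\<close> times the length. In a fine partition, the intervals of the first
  kind have small total length, hence small total variation by absolute continuity; the others
  contribute at most \<open>\<epsilon> * (b - a)\<close>.\<close>

lemma abs_continuous_antimono:
  fixes f :: "real \<Rightarrow> real"
  assumes ab: "a \<le> b" and ac: "abs_continuous_on {a..b} f"
    and ae: "AE x in lebesgue. x \<in> {a..b} \<longrightarrow>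
      (\<exists>D\<le>0. (f has_real_derivative D) (at x within {a..b}))"
  shows "f b \<le> f a"
proof (rule field_le_epsilon)
  fix e :: real assume "e > 0"
  define \<epsilon> where "\<epsilon> = e / (b - a + 1)"
  have \<epsilon>: "\<epsilon> > 0" using \<open>e > 0\<close> ab by (simp add: \<epsilon>_def)
  have e: "\<epsilon> * (b - a) + \<epsilon> = e" 
  proof -
    have "\<epsilon> * (b - a + 1) = e" using ab by (simp add: \<epsilon>_def)
    then show ?thesis by (simp add: algebra_simps)
  qed
  obtain \<delta> where \<delta>: "\<delta> > 0" "\<And>d. d division_of \<Union>d \<Longrightarrow> \<Union>d \<subseteq> {a..b} \<Longrightarrow> (\<Sum>k\<in>d. Sup k - Inf k) < \<delta> \<Longrightarrow>
       (\<Sum>k\<in>d. \<bar>f (Sup k) - f (Inf k)\<bar>) < \<epsilon>"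
    using abs_continuous_onE[OF ac \<epsilon>] by blast
  obtain N where N: "N \<in> null_sets lebesgue"
    and good: "\<And>x. x \<in> {a..b} \<Longrightarrow> x \<notin> N \<Longrightarrow> \<exists>D\<le>0. (f has_real_derivative D) (at x within {a..b})"
    using ae by (auto elim!: AE_E3)
  obtain U where U: "open U" "N \<subseteq> U" and UN: "U - N \<in> lmeasurable" "emeasure lebesgue (U - N) < ennreal \<delta>"
    using sets_lebesgue_outer_open[of N \<delta>] N \<delta>(1) by auto
  have "N \<in> lmeasurable" "measure lebesgue N = 0"
    using N by (auto simp: negligible_iff_null_sets[symmetric] negligible_imp_measurable negligible_imp_measure0)
  then have Um: "U \<in> lmeasurable" and "measure lebesgue U \<le> measure lebesgue (U - N) + measure lebesgue N"
    using UN(1) U(2) fmeasurable.Un[of "U - N" lebesgue N] measure_Un_le[of "U - N" lebesgue N]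
    by (auto simp: Un_absorb2 fmeasurableD)
  with \<open>measure lebesgue N = 0\<close> UN have mU: "measure lebesgue U < \<delta>"
    by (simp add: emeasure_eq_measure2 \<delta>(1) ennreal_less_iff)
  have "\<exists>r>0. (x \<in> N \<longrightarrow> ball x r \<subseteq> U) \<and>
      (x \<in> {a..b} - N \<longrightarrow> (\<forall>u\<in>{a..b}. \<forall>v\<in>{a..b}. u \<le> x \<and> x \<le> v \<and> \<bar>u - x\<bar> < r \<and> \<bar>v - x\<bar> < r \<longrightarrow>
         f v - f u \<le> \<epsilon> * (v - u)))" for x
  proof (cases "x \<in> N")
    case True
    then show ?thesis using U by (meson Diff_iff openE subsetD)
  next
    case False
    show ?thesis
    proof (cases "x \<in> {a..b}")
      case True
      then obtain D where D: "D \<le> 0" "(f has_real_derivative D) (at x within {a..b})"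
        using good False by blast
      obtain r where r: "r > 0" "\<And>u v. u \<in> {a..b} \<Longrightarrow> v \<in> {a..b} \<Longrightarrow> u \<le> x \<Longrightarrow> x \<le> v \<Longrightarrow>
          \<bar>u - x\<bar> < r \<Longrightarrow> \<bar>v - x\<bar> < r \<Longrightarrow> f v - f u \<le> (D + \<epsilon>) * (v - u)"
        using has_real_derivative_straddle[OF D(2) \<epsilon>] by blast
      have "(D + \<epsilon>) * (v - u) \<le> \<epsilon> * (v - u)" if "u \<le> x" "x \<le> v" for u v
        using D(1) that by (intro mult_right_mono) auto
      with r(2) have "\<forall>u\<in>{a..b}. \<forall>v\<in>{a..b}. u \<le> x \<and> x \<le> v \<and> \<bar>u - x\<bar> < r \<and> \<bar>v - x\<bar> < r \<longrightarrow>
         f v - f u \<le> \<epsilon> * (v - u)"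
        by (meson order_trans)
      with r(1) \<open>x \<notin> N\<close> show ?thesis
        by blast
    next
      case False
      then show ?thesis using \<open>x \<notin> N\<close> by (auto intro: exI[of _ 1])
    qed
  qed
  then obtain r where r: "\<And>x. r x > 0" and rN: "\<And>x. x \<in> N \<Longrightarrow> ball x (r x) \<subseteq> U"
    and rG: "\<And>x u v. x \<in> {a..b} \<Longrightarrow> x \<notin> N \<Longrightarrow> u \<in> {a..b} \<Longrightarrow> v \<in> {a..b} \<Longrightarrow> u \<le> x \<Longrightarrow> x \<le> v \<Longrightarrow>
      \<bar>u - x\<bar> < r x \<Longrightarrow> \<bar>v - x\<bar> < r x \<Longrightarrow> f v - f u \<le> \<epsilon> * (v - u)"
    unfolding Diff_iff by metis
  obtain p where p: "p tagged_division_of {a..b}" "(\<lambda>x. ball x (r x)) fine p"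
    using fine_division_exists_real[OF gauge_ball_dependent, of r] r by blast
  define q where "q = {(x, k). (x, k) \<in> p \<and> x \<in> N}"
  have fin: "finite p" and qp: "q \<subseteq> p"
    using p by (auto simp: q_def)
  have q: "q tagged_partial_division_of {a..b}"
    using p(1) qp tagged_partial_division_subset tagged_division_of_def by blast
  let ?d = "snd ` q"
  have d: "?d division_of \<Union>?d"
    by (rule partial_division_of_tagged_division[OF q])
  have dab: "\<Union>?d \<subseteq> {a..b}"
    using tagged_partial_division_ofD(3)[OF q] by fastforce
  have dU: "\<Union>?d \<subseteq> U"
    using p(2) rN by (force simp: q_def fine_def)
  have "(\<Sum>k\<in>?d. Sup k - Inf k) = (\<Sum>k\<in>?d. measure lebesgue k)"
    using division_of_real_memberD[OF d] by (intro sum.cong refl) 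
      (metis measure_lborel_Icc measure_completion atLeastAtMost_borel sets_lborel)
  also have "\<dots> = measure lebesgue (\<Union>?d)"
    by (rule content_division[OF d])
  also have "\<dots> \<le> measure lebesgue U"
    using dU Um d by (intro measure_mono_fmeasurable) (auto intro: fmeasurableD lmeasurable_division)
  finally have bad: "(\<Sum>k\<in>?d. \<bar>f (Sup k) - f (Inf k)\<bar>) < \<epsilon>"
    using mU by (intro \<delta>(2) d dab) auto
  have "(\<Sum>(x,k)\<in>q. f (Sup k) - f (Inf k)) \<le> (\<Sum>(x,k)\<in>q. \<bar>f (Sup k) - f (Inf k)\<bar>)"
    by (intro sum_mono) auto
  \<comment> \<open>The empty interval gets the value \<open>0\<close> because the next rule asks it of every degenerate interval,
    and \<open>Sup\<close> and \<open>Inf\<close> of the empty set are unspecified.\<close>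
  also have "\<dots> = (\<Sum>(x,k)\<in>q. if k = {} then 0 else \<bar>f (Sup k) - f (Inf k)\<bar>)"
    using tagged_partial_division_ofD(2)[OF q] by (intro sum.cong) fastforce+
  also have "\<dots> = (\<Sum>k\<in>?d. if k = {} then 0 else \<bar>f (Sup k) - f (Inf k)\<bar>)"
  proof (rule sum.over_tagged_division_lemma[OF tagged_partial_division_of_Union_self[OF q]])
    fix u v :: real assume uv: "box u v = {}"
    show "(if cbox u v = {} then 0 else \<bar>f (Sup (cbox u v)) - f (Inf (cbox u v))\<bar>) = 0"
      using uv by (cases "u = v") (auto simp: not_less)
  qed
  also have "\<dots> = (\<Sum>k\<in>?d. \<bar>f (Sup k) - f (Inf k)\<bar>)"
    using tagged_partial_division_ofD(2)[OF q] by (intro sum.cong) fastforce+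
  also note bad
  finally have badq: "(\<Sum>(x,k)\<in>q. f (Sup k) - f (Inf k)) < \<epsilon>" .
  have "(\<Sum>(x,k)\<in>p - q. f (Sup k) - f (Inf k)) \<le> (\<Sum>(x,k)\<in>p - q. \<epsilon> * (Sup k - Inf k))"
  proof (intro sum_mono, clarify)
    fix x k assume xk: "(x, k) \<in> p" "(x, k) \<notin> q"
    obtain u v where k: "k = cbox u v" using tagged_division_ofD(4)[OF p(1) xk(1)] by blast
    have "x \<in> k" "k \<subseteq> {a..b}" using tagged_division_ofD(2,3)[OF p(1) xk(1)] by auto
    moreover have "k \<subseteq> ball x (r x)" using p(2) xk by (auto simp: fine_def)
    moreover have "x \<notin> N" using xk by (auto simp: q_def)
    moreover have "u \<in> k" "v \<in> k" using k \<open>x \<in> k\<close> by auto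
    ultimately have "\<bar>u - x\<bar> < r x" "\<bar>v - x\<bar> < r x" "x \<in> {a..b}" "u \<in> {a..b}" "v \<in> {a..b}"
      using subsetD[of k "ball x (r x)" u] subsetD[of k "ball x (r x)" v] by (auto simp: dist_real_def abs_minus_commute)
    then have "f v - f u \<le> \<epsilon> * (v - u)"
      using rG[of x u v] \<open>x \<notin> N\<close> \<open>x \<in> k\<close> k by auto
    then show "f (Sup k) - f (Inf k) \<le> \<epsilon> * (Sup k - Inf k)"
      using \<open>x \<in> k\<close> k by auto
  qed
  also have "\<dots> \<le> (\<Sum>(x,k)\<in>p. \<epsilon> * (Sup k - Inf k))"
  proof (rule sum_mono2[OF fin])
    fix z assume "z \<in> p - (p - q)"
    then obtain x k where z: "z = (x, k)" "(x, k) \<in> p" by (metis Diff_iff surj_pair)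
    obtain u v where k: "k = cbox u v" using tagged_division_ofD(4)[OF p(1) z(2)] by blast
    have "x \<in> k" using tagged_division_ofD(2)[OF p(1) z(2)] .
    then show "0 \<le> (case z of (x, k) \<Rightarrow> \<epsilon> * (Sup k - Inf k))"
      using z k \<epsilon> by auto
  qed auto
  also have "\<dots> = \<epsilon> * (\<Sum>(x,k)\<in>p. Sup k - Inf k)"
    by (simp add: sum_distrib_left case_prod_unfold)
  also have "\<dots> = \<epsilon> * (b - a)"
    using additive_tagged_division_1[OF ab p(1), of "\<lambda>x. x"] by simp
  finally have "(\<Sum>(x,k)\<in>p - q. f (Sup k) - f (Inf k)) \<le> \<epsilon> * (b - a)" .
  moreover have "f b - f a = (\<Sum>(x,k)\<in>p - q. f (Sup k) - f (Inf k)) + (\<Sum>(x,k)\<in>q. f (Sup k) - f (Inf k))"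
    using additive_tagged_division_1[OF ab p(1), of f] sum.subset_diff[OF qp fin, of "\<lambda>(x, k). f (Sup k) - f (Inf k)"] by simp
  ultimately show "f b \<le> f a + e"
    using badq e by linarith
qed

text \<open>Each decay estimate below is a differential inequality \<open>f' \<le> \<phi>' * f\<close> valid almost everywhere. The
  function \<open>f * exp (- \<phi>)\<close> is absolutely continuous with nonpositive derivative.\<close>

lemma gronwall_abs_continuous:
  fixes f \<phi> \<phi>' :: "real \<Rightarrow> real"
  assumes ab: "a \<le> b" and f: "abs_continuous_on {a..b} f"
    and \<phi>: "\<And>x. x \<in> {a..b} \<Longrightarrow> (\<phi> has_real_derivative \<phi>' x) (at x within {a..b})"
    and \<phi>': "continuous_on {a..b} \<phi>'"
    and ae: "AE x in lebesgue. x \<in> {a..b} \<longrightarrow>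
      (\<exists>D\<le>\<phi>' x * f x. (f has_real_derivative D) (at x within {a..b}))"
  shows "f b \<le> exp (\<phi> b - \<phi> a) * f a"
proof -
  let ?e = "\<lambda>x. exp (- \<phi> x)"
  have d: "(?e has_real_derivative - \<phi>' x * ?e x) (at x within {a..b})" if "x \<in> {a..b}" for x
    using \<phi>[OF that] by (auto intro!: derivative_eq_intros)
  have "continuous_on {a..b} \<phi>"
    using \<phi> DERIV_continuous_on by blast
  then have "abs_continuous_on {a..b} ?e"
    by (intro abs_continuous_on_C1[OF d] continuous_intros \<phi>')
  then have "abs_continuous_on {a..b} (\<lambda>x. f x * ?e x)"
    by (rule abs_continuous_on_mult[OF f])
  then have "f b * ?e b \<le> f a * ?e a"
  proof (rule abs_continuous_antimono[OF ab])
    show "AE x in lebesgue. x \<in> {a..b} \<longrightarrow>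
      (\<exists>D\<le>0. ((\<lambda>x. f x * ?e x) has_real_derivative D) (at x within {a..b}))"
      using ae
    proof eventually_elim
      case (elim x)
      show ?case
      proof
        assume x: "x \<in> {a..b}"
        then obtain D where D: "D \<le> \<phi>' x * f x" "(f has_real_derivative D) (at x within {a..b})"
          using elim by blast
        have "((\<lambda>x. f x * ?e x) has_real_derivative (D - \<phi>' x * f x) * ?e x) (at x within {a..b})"
          using DERIV_mult[OF D(2) d[OF x]] by (simp add: algebra_simps)
        moreover have "(D - \<phi>' x * f x) * ?e x \<le> 0"
          using D(1) by (intro mult_nonpos_nonneg) auto
        ultimately show "\<exists>D\<le>0. ((\<lambda>x. f x * ?e x) has_real_derivative D) (at x within {a..b})"
          by blast
      qed
    qed
  qed
  then show ?thesis
    by (simp add: exp_diff exp_minus field_simps)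
qed

text \<open>A zero at which the derivative does not vanish is isolated among the zeros, and a discrete subset
  of the line is countable because the line has a countable basis.\<close>

lemma countable_simple_zeros:
  fixes g :: "real \<Rightarrow> real"
  shows "countable {x \<in> S. g x = 0 \<and> (\<exists>D. D \<noteq> 0 \<and> (g has_real_derivative D) (at x within S))}" (is "countable ?Z")
proof -
  define Z where "Z = ?Z"
  obtain B :: "real set set" where B: "countable B" "topological_basis B"
    using ex_countable_basis by blast
  have "\<exists>U\<in>B. U \<inter> Z = {x}" if x: "x \<in> Z" for x
  proof -
    obtain D where D: "D \<noteq> 0" "(g has_real_derivative D) (at x within S)" using x unfolding Z_def by blast
    have "((\<lambda>y. (g y - g x) / (y - x)) \<longlongrightarrow> D) (at x within S)"
      using D(2) by (simp add: has_field_derivative_iff)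
    then have "\<forall>\<^sub>F y in at x within S. (g y - g x) / (y - x) \<noteq> 0"
      using D(1) tendsto_imp_eventually_ne by blast
    then obtain U where U: "open U" "x \<in> U" "\<And>y. y \<in> U \<Longrightarrow> y \<noteq> x \<Longrightarrow> y \<in> S \<Longrightarrow> (g y - g x) / (y - x) \<noteq> 0"
      unfolding eventually_at_topological by blast
    obtain V where V: "V \<in> B" "x \<in> V" "V \<subseteq> U"
      using topological_basisE[OF B(2) U(1,2)] by blast
    have "y = x" if "y \<in> V" "y \<in> Z" for y
      using U(3)[of y] V that x by (auto simp: Z_def)
    then show ?thesis using V x by blast
  qed
  then obtain h where h: "\<And>x. x \<in> Z \<Longrightarrow> h x \<in> B \<and> h x \<inter> Z = {x}" by metis
  then have "inj_on h Z"
    by (intro inj_onI) (metis singleton_inject)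
  moreover have "h ` Z \<subseteq> B" using h by blast
  ultimately have "countable Z"
    by (intro countable_image_inj_on[of h Z] countable_subset[OF _ B(1)])
  then show ?thesis unfolding Z_def .
qed

lemma has_real_derivative_abs:
  fixes g :: "real \<Rightarrow> real"
  assumes g: "(g has_real_derivative D) (at x within S)" and "g x \<noteq> 0 \<or> D = 0"
  shows "((\<lambda>x. \<bar>g x\<bar>) has_real_derivative sgn (g x) * D) (at x within S)"
proof (cases "g x = 0")
  case False
  have "((\<lambda>x. sqrt ((g x)\<^sup>2)) has_real_derivative inverse (sqrt ((g x)\<^sup>2)) / 2 * (2 * g x * D)) (at x within S)"
    by (rule DERIV_chain2[OF DERIV_real_sqrt]) (use False g in \<open>auto intro!: derivative_eq_intros\<close>)
  moreover have "inverse (sqrt ((g x)\<^sup>2)) / 2 * (2 * g x * D) = sgn (g x) * D"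
    using False by (simp add: sgn_if)
  ultimately show ?thesis
    by (simp only: real_sqrt_abs)
next
  case True
  then have "((\<lambda>y. g y / (y - x)) \<longlongrightarrow> 0) (at x within S)"
    using assms by (simp add: has_field_derivative_iff)
  then have "((\<lambda>y. \<bar>g y\<bar> / (y - x)) \<longlongrightarrow> 0) (at x within S)"
    by (subst (asm) tendsto_rabs_zero_iff[symmetric], subst tendsto_rabs_zero_iff[symmetric]) (simp add: abs_divide)
  then show ?thesis
    using True by (simp add: has_field_derivative_iff)
qed

text \<open>The absolute value is not differentiable at the simple zeros of \<open>g\<close>, but these are only countably
  many. At any other zero the derivative of \<open>g\<close> is \<open>0\<close>, in agreement with the convention
  \<open>sgn 0 = 0\<close>.\<close>

lemma AE_has_real_derivative_abs:
  fixes g :: "real \<Rightarrow> real"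
  shows "AE x in lebesgue. x \<in> S \<longrightarrow> (\<forall>D. (g has_real_derivative D) (at x within S) \<longrightarrow>
      ((\<lambda>x. \<bar>g x\<bar>) has_real_derivative sgn (g x) * D) (at x within S))"
proof -
  let ?Z = "{x \<in> S. g x = 0 \<and> (\<exists>D. D \<noteq> 0 \<and> (g has_real_derivative D) (at x within S))}"
  have "?Z \<in> null_sets lebesgue"
    by (intro null_sets_completionI countable_imp_null_set_lborel countable_simple_zeros)
  then have "AE x in lebesgue. x \<notin> ?Z" by (rule AE_not_in)
  then show ?thesis
    by eventually_elim (use has_real_derivative_abs in blast)
qed

section \<open>Energy decay for a single frequency\<close>

text \<open>A single frequency \<open>c\<close> of the equation. The last assumption is the equation solved for the second
  derivative, in the form in which it enters the derivatives of the functionals below.\<close>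

locale damped_oscillator =
  fixes t0 m M c :: real and b y y' :: "real \<Rightarrow> real"
  assumes t0: "t0 > 0" and m: "m > 0" and c: "c \<ge> 0"
    and b_lower: "\<And>t. t \<ge> t0 \<Longrightarrow> m / t \<le> b t" and b_upper: "\<And>t. t \<ge> t0 \<Longrightarrow> b t \<le> M / t"
    and deriv: "\<And>t. t \<ge> t0 \<Longrightarrow> (y has_real_derivative y' t) (at t within {t0..})"
    and deriv_ac: "\<And>T. T > t0 \<Longrightarrow> abs_continuous_on {t0..T} y'"
    and ode: "AE t in lebesgue. t0 \<le> t \<longrightarrow>
      (y' has_real_derivative - (b t * y' t + c\<^sup>2 * y t)) (at t within {t0..})"
begin

definition energy :: "real \<Rightarrow> real" where
  "energy t = (y' t)\<^sup>2 + c\<^sup>2 * (y t)\<^sup>2"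

lemma energy_nonneg: "0 \<le> energy t"
  by (simp add: energy_def)

lemma m_le_M: "m \<le> M"
  using order_trans[OF b_lower[of t0] b_upper[of t0]] t0 by (simp add: divide_le_cancel)

lemma deriv_Icc:
  assumes "t0 \<le> r" "t \<in> {r..s}"
  shows "(y has_real_derivative y' t) (at t within {r..s})"
  using deriv[of t] assms by (auto intro: DERIV_subset)

lemma abs_continuous_deriv:
  assumes "t0 \<le> r" shows "abs_continuous_on {r..s} y'"
  using assms abs_continuous_on_subset[OF deriv_ac[of "max s (t0 + 1)"], of "{r..s}"] by auto

lemma abs_continuous_solution:
  assumes "t0 \<le> r" shows "abs_continuous_on {r..s} y"
  by (rule abs_continuous_on_C1[OF deriv_Icc[OF assms]])
     (auto intro: abs_continuous_on_imp_continuous_on abs_continuous_deriv assms)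

text \<open>In a Gronwall argument along the solution it suffices to compute derivatives at times at which the
  equation holds and at which \<open>\<bar>y\<bar>\<close> and \<open>\<bar>y'\<bar>\<close> are differentiable with the expected derivatives; the last
  premise asks for no more than that.\<close>

lemma gronwall_along:
  assumes "t0 \<le> r" "r \<le> s"
    and "abs_continuous_on {r..s} f"
    and "\<And>t. t \<in> {r..s} \<Longrightarrow> (\<phi> has_real_derivative \<phi>' t) (at t within {r..s})"
    and "continuous_on {r..s} \<phi>'"
    and D: "\<And>t. t \<in> {r..s} \<Longrightarrow>
      (y' has_real_derivative - (b t * y' t + c\<^sup>2 * y t)) (at t within {r..s}) \<Longrightarrow>
      (\<And>g g'. g \<in> {y, y'} \<Longrightarrow> (g has_real_derivative g') (at t within {r..s}) \<Longrightarrow>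
         ((\<lambda>x. \<bar>g x\<bar>) has_real_derivative sgn (g t) * g') (at t within {r..s})) \<Longrightarrow>
      \<exists>D\<le>\<phi>' t * f t. (f has_real_derivative D) (at t within {r..s})"
  shows "f s \<le> exp (\<phi> s - \<phi> r) * f r"
proof (rule gronwall_abs_continuous[OF assms(2-5)])
  show "AE t in lebesgue. t \<in> {r..s} \<longrightarrow>
      (\<exists>D\<le>\<phi>' t * f t. (f has_real_derivative D) (at t within {r..s}))"
    using ode AE_has_real_derivative_abs[of "{r..s}" y] AE_has_real_derivative_abs[of "{r..s}" y']
  proof eventually_elim
    case (elim t)
    show ?case
    proof
      assume t: "t \<in> {r..s}"
      have "(y' has_real_derivative - (b t * y' t + c\<^sup>2 * y t)) (at t within {r..s})"
        using elim(1) t assms(1) by (auto intro: DERIV_subset)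
      then show "\<exists>D\<le>\<phi>' t * f t. (f has_real_derivative D) (at t within {r..s})"
        using elim(2,3) t by (intro D) auto
    qed
  qed
qed

lemma abs_continuous_energy:
  assumes "t0 \<le> r" shows "abs_continuous_on {r..s} energy"
proof -
  have "abs_continuous_on {r..s} (\<lambda>t. y' t * y' t + (c * y t) * (c * y t))"
    using assms by (intro abs_continuous_on_add abs_continuous_on_mult abs_continuous_solution abs_continuous_deriv abs_continuous_on_C1[of _ _ "\<lambda>_. c" "\<lambda>_. 0"]) auto
  moreover have "energy = (\<lambda>t. y' t * y' t + (c * y t) * (c * y t))"
    by (rule ext) (simp add: energy_def power2_eq_square)
  ultimately show ?thesis by simp
qed

text \<open>Only the damping dissipates energy, and only through \<open>y'\<close>. The energy alone thus yields no decay
  rate, since nothing here bounds the potential energy; this is why other functionals are needed.\<close>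

lemma energy_has_derivative:
  assumes "t \<in> S" "S \<subseteq> {t0..}"
    and "(y' has_real_derivative - (b t * y' t + c\<^sup>2 * y t)) (at t within S)"
  shows "(energy has_real_derivative - 2 * b t * (y' t)\<^sup>2) (at t within S)"
proof -
  have "(y has_real_derivative y' t) (at t within S)"
    using deriv[of t] assms(1,2) by (auto intro: DERIV_subset)
  then have "(energy has_real_derivative
      2 * y' t * - (b t * y' t + c\<^sup>2 * y t) + c\<^sup>2 * (2 * y t * y' t)) (at t within S)"
    unfolding energy_def using assms(3) by (auto intro!: derivative_eq_intros)
  then show ?thesis
    by (simp add: power2_eq_square algebra_simps)
qed

text \<open>Once \<open>c * t\<close> is bounded below, kinetic and potential energy exchange faster than the damping
  acts. Adding \<open>(\<mu> / t) * y * y'\<close> to the energy spreads the dissipation over both: up to the cross term,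
  the derivative of the sum is at most \<open>- \<mu> / t\<close> times the energy. The cross term is controlled through
  \<open>2 * c * \<bar>y * y'\<bar> \<le> energy\<close>, at the price of a relative error of order \<open>1 / (c * t\<^sup>2)\<close>,
  which is integrable at infinity with integral of order \<open>1 / (c * T)\<close>.\<close>

lemma energy_decay_oscillating:
  assumes \<mu>: "0 < \<mu>" "\<mu> \<le> m" and T: "t0 \<le> T" "\<mu> \<le> c * T" and t: "T \<le> t"
  shows "energy t \<le> exp (\<mu> * (2 * M + 5) / (2 * (c * T))) * (T / t) powr \<mu> * energy T"
proof -
  have pos: "T > 0" "t > 0" using t0 T t by auto
  have c: "c > 0" using \<mu> T(2) c by (cases "c = 0") auto
  define h where "h = \<mu> * (M + 1 - \<mu>) / c"
  define f where "f = (\<lambda>s. energy s + \<mu> / s * (y s * y' s))"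
  \<comment> \<open>Twice \<open>x\<close> is at most \<open>1\<close>, so the modified functional lies between \<open>1 - x\<close> and \<open>1 + x\<close> times the
    energy. The two comparisons cost the factors \<open>exp x\<close> and \<open>exp (2 * x)\<close>, and integrating the error
    term costs \<open>exp (2 * x * (M + 1 - \<mu>))\<close>.\<close>
  define x where "x = \<mu> / (2 * (c * T))"
  have x: "0 \<le> x" "x \<le> 1 / 2" using \<mu> T c pos by (auto simp: x_def field_simps)
  have cross: "\<bar>\<mu> / s * (y s * y' s)\<bar> \<le> x * energy s" "2 * c * \<bar>y s * y' s\<bar> \<le> energy s" if s: "T \<le> s" for s
  proof -
    have "0 \<le> (\<bar>y' s\<bar> - c * \<bar>y s\<bar>)\<^sup>2" by simp
    then show A: "2 * c * \<bar>y s * y' s\<bar> \<le> energy s"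
      by (simp add: energy_def power2_eq_square algebra_simps abs_mult)
    have "\<bar>\<mu> / s * (y s * y' s)\<bar> = \<mu> / s * \<bar>y s * y' s\<bar>"
      using s pos \<mu> by (simp add: abs_mult)
    also have "\<dots> \<le> \<mu> / T * \<bar>y s * y' s\<bar>"
      using s pos \<mu> by (intro mult_right_mono) (auto simp: frac_le)
    also have "\<dots> = x * (2 * c * \<bar>y s * y' s\<bar>)"
      using c by (simp add: x_def)
    also have "\<dots> \<le> x * energy s" using A x(1) by (rule mult_left_mono)
    finally show "\<bar>\<mu> / s * (y s * y' s)\<bar> \<le> x * energy s" .
  qed
  have half: "energy s \<le> 2 * f s" if "T \<le> s" for s
  proof -
    have "- (\<mu> / s * (y s * y' s)) \<le> 1 / 2 * energy s"
      using cross(1)[OF that] mult_right_mono[OF x(2) energy_nonneg[of s]]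
      unfolding abs_le_iff by (blast intro: order_trans)
    then show ?thesis by (simp add: f_def)
  qed
  let ?\<phi> = "\<lambda>s. - \<mu> * ln s - h / s"
  let ?\<phi>' = "\<lambda>s. - \<mu> / s + h / s\<^sup>2"
  have "f t \<le> exp (?\<phi> t - ?\<phi> T) * f T"
  proof (rule gronwall_along[OF T(1) t, where \<phi>' = ?\<phi>'])
    show "abs_continuous_on {T..t} f"
      unfolding f_def
      by (intro abs_continuous_on_add abs_continuous_on_mult abs_continuous_energy abs_continuous_solution abs_continuous_deriv T
            abs_continuous_on_C1[of _ _ "\<lambda>s. \<mu> / s" "\<lambda>s. - \<mu> / s\<^sup>2"])
         (use pos in \<open>auto intro!: derivative_eq_intros continuous_intros simp: power2_eq_square\<close>)
    show "(?\<phi> has_real_derivative ?\<phi>' s) (at s within {T..t})" if "s \<in> {T..t}" for s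
      using that pos by (auto intro!: derivative_eq_intros simp: power2_eq_square)
    show "continuous_on {T..t} ?\<phi>'"
      using pos by (auto intro!: continuous_intros)
    fix s assume s: "s \<in> {T..t}"
      and D2: "(y' has_real_derivative - (b s * y' s + c\<^sup>2 * y s)) (at s within {T..t})"
    have spos: "s > 0" using s pos by auto
    have D1: "(y has_real_derivative y' s) (at s within {T..t})"
      using deriv_Icc[OF T(1) s] .
    let ?D = "- (2 * b s - \<mu> / s) * (y' s)\<^sup>2 - \<mu> / s * (c\<^sup>2 * (y s)\<^sup>2) - \<mu> / s * (b s + 1 / s) * (y s * y' s)"
    have "((\<lambda>s. \<mu> / s) has_real_derivative - (\<mu> / s\<^sup>2)) (at s within {T..t})"
      using spos by (auto intro!: derivative_eq_intros simp: power2_eq_square)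
    from DERIV_add[OF energy_has_derivative[OF s _ D2] DERIV_mult'[OF this DERIV_mult'[OF D1 D2]]]
    have "(f has_real_derivative - 2 * b s * (y' s)\<^sup>2 + (\<mu> / s * (y s * - (b s * y' s + c\<^sup>2 * y s) + y' s * y' s)
        + - (\<mu> / s\<^sup>2) * (y s * y' s))) (at s within {T..t})"
      unfolding f_def using T(1) by auto
    also have "- 2 * b s * (y' s)\<^sup>2 + (\<mu> / s * (y s * - (b s * y' s + c\<^sup>2 * y s) + y' s * y' s)
        + - (\<mu> / s\<^sup>2) * (y s * y' s)) = ?D"
      by (simp add: divide_inverse algebra_simps power2_eq_square)
    finally have "(f has_real_derivative ?D) (at s within {T..t})" .
    moreover have "?D \<le> ?\<phi>' s * f s"
    proof -
      let ?z = "y s * y' s"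
      have bs: "\<mu> / s \<le> b s" "b s \<le> M / s"
        using b_lower[of s] b_upper[of s] s T(1) divide_right_mono[OF \<mu>(2), of s] spos by auto
      have "(\<mu> / s - b s - 1 / s) * ?z \<le> (M + 1 - \<mu>) / s * \<bar>?z\<bar>"
      proof -
        have "\<bar>\<mu> / s - b s - 1 / s\<bar> \<le> (M + 1 - \<mu>) / s"
          using bs spos zero_le_divide_1_iff[of s] unfolding diff_divide_distrib add_divide_distrib abs_le_iff
          by linarith
        then have "\<bar>(\<mu> / s - b s - 1 / s) * ?z\<bar> \<le> (M + 1 - \<mu>) / s * \<bar>?z\<bar>"
          unfolding abs_mult[of _ ?z] by (rule mult_right_mono) simp
        then show ?thesis by (rule order_trans[OF abs_ge_self])
      qed
      also have "(M + 1 - \<mu>) / s * \<bar>?z\<bar> \<le> (M + 1 - \<mu>) / s * (f s / c)"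
      proof (rule mult_left_mono)
        show "\<bar>?z\<bar> \<le> f s / c"
          using cross(2)[of s] half[of s] s c by (simp add: field_simps)
        show "0 \<le> (M + 1 - \<mu>) / s" using \<mu> m_le_M spos by simp
      qed
      finally have key: "(\<mu> / s - b s - 1 / s) * ?z \<le> (M + 1 - \<mu>) / s * (f s / c)" .
      \<comment> \<open>Separate the intended decay \<open>- (\<mu> / s) * f s\<close> from the surplus damping, which has a sign, and the
        cross terms.\<close>
      have "?D = - (\<mu> / s) * f s - 2 * (b s - \<mu> / s) * (y' s)\<^sup>2 + \<mu> / s * ((\<mu> / s - b s - 1 / s) * ?z)"
        by (simp add: f_def energy_def algebra_simps)
      also have "\<dots> \<le> - (\<mu> / s) * f s + \<mu> / s * ((\<mu> / s - b s - 1 / s) * ?z)"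
        using bs by simp
      also have "\<dots> \<le> - (\<mu> / s) * f s + \<mu> / s * ((M + 1 - \<mu>) / s * (f s / c))"
        using \<mu> spos by (intro add_left_mono mult_left_mono key) simp
      also have "\<dots> = ?\<phi>' s * f s"
        by (simp add: h_def field_simps power2_eq_square)
      finally show ?thesis .
    qed
    ultimately show "\<exists>D\<le>?\<phi>' s * f s. (f has_real_derivative D) (at s within {T..t})"
      by blast
  qed
  also have "exp (?\<phi> t - ?\<phi> T) \<le> exp (2 * x * (M + 1 - \<mu>)) * (T / t) powr \<mu>"
  proof -
    have "h / T = 2 * x * (M + 1 - \<mu>)" by (simp add: h_def x_def)
    moreover have "0 \<le> h / t" using \<mu> m_le_M c pos by (simp add: h_def)
    moreover have "(T / t) powr \<mu> = exp (\<mu> * (ln T - ln t))"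
      using pos by (simp add: powr_def ln_div)
    ultimately show ?thesis
      by (simp add: algebra_simps flip: exp_add)
  qed
  finally have ft: "f t \<le> exp (2 * x * (M + 1 - \<mu>)) * (T / t) powr \<mu> * f T"
    using half[of T] energy_nonneg[of T] by (simp add: mult_right_mono)
  have fT: "f T \<le> exp x * energy T"
  proof -
    have "f T \<le> (1 + x) * energy T"
      using cross(1)[of T] unfolding f_def abs_le_iff distrib_right by simp
    also have "\<dots> \<le> exp x * energy T"
      by (intro mult_right_mono energy_nonneg exp_ge_add_one_self)
    finally show ?thesis .
  qed
  have Et: "energy t \<le> exp (2 * x) * f t"
  proof -
    have "f t \<ge> (1 - x) * energy t"
      using cross(1)[OF t] unfolding f_def abs_le_iff left_diff_distrib by simp
    moreover have "1 \<le> (1 + 2 * x) * (1 - x)"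
      using x mult_left_mono[OF x(2) x(1)] by (simp add: algebra_simps)
    ultimately have "1 * energy t \<le> (1 + 2 * x) * (1 - x) * energy t"
      "(1 + 2 * x) * ((1 - x) * energy t) \<le> (1 + 2 * x) * f t"
      using x energy_nonneg[of t] by (intro mult_right_mono mult_left_mono; simp)+
    then have "energy t \<le> (1 + 2 * x) * f t"
      unfolding mult.assoc mult_1 by (rule order_trans)
    also have "\<dots> \<le> exp (2 * x) * f t"
      using half[OF t] energy_nonneg[of t] by (intro mult_right_mono exp_ge_add_one_self) auto
    finally show ?thesis .
  qed
  have "energy t \<le> exp (2 * x) * (exp (2 * x * (M + 1 - \<mu>)) * (T / t) powr \<mu> * (exp x * energy T))"
  proof -
    have "f t \<le> exp (2 * x * (M + 1 - \<mu>)) * (T / t) powr \<mu> * (exp x * energy T)"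
      by (rule order_trans[OF ft mult_left_mono[OF fT]]) simp
    then show ?thesis
      by (intro order_trans[OF Et] mult_left_mono) auto
  qed
  also have "\<dots> = exp (x * (2 * M + 5 - 2 * \<mu>)) * ((T / t) powr \<mu> * energy T)"
    by (simp add: algebra_simps flip: exp_add)
  also have "\<dots> \<le> exp (x * (2 * M + 5)) * ((T / t) powr \<mu> * energy T)"
    using x(1) \<mu> by (intro mult_right_mono) (auto simp: energy_nonneg mult_left_mono)
  finally show ?thesis
    by (simp add: x_def mult.assoc)
qed

text \<open>While \<open>c * t\<close> is bounded, the potential energy is too weak to be dissipated through oscillation, and
  the functional has to control \<open>y\<^sup>2 / t\<^sup>2\<close> instead. With the coefficient \<open>m * (2 - m)\<close> its derivative is
  \<open>- (m / t) * f\<close>, minus a perfect square and the surplus damping, plus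
  \<open>m * c\<^sup>2 * y\<^sup>2 / t\<close>. The latter is absorbed by \<open>c\<^sup>2 * t / (2 - m)\<close> times the functional, a rate whose
  integral is bounded as long as \<open>c * t\<close> is. The coefficient of \<open>y\<^sup>2 / t\<^sup>2\<close> tends to \<open>0\<close> with \<open>m\<close>, which makes
  the bound usable for small \<open>m\<close>; it degenerates as \<open>m\<close> approaches \<open>2\<close>.\<close>

lemma energy_bound_inertial_small_damping:
  assumes m2: "m < 2" and t: "t0 \<le> t"
  shows "energy t \<le> exp (c\<^sup>2 * t\<^sup>2 / (2 * (2 - m))) * (t0 / t) powr m *
           (energy t0 + m * (2 - m) * (y t0)\<^sup>2 / t0\<^sup>2)"
proof -
  define \<kappa> where "\<kappa> = m * (2 - m)"
  have \<kappa>: "\<kappa> > 0" using m m2 by (simp add: \<kappa>_def)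
  define f where "f = (\<lambda>s. energy s + \<kappa> / s\<^sup>2 * (y s * y s))"
  let ?\<phi> = "\<lambda>s. - m * ln s + c\<^sup>2 * s\<^sup>2 / (2 * (2 - m))"
  let ?\<phi>' = "\<lambda>s. - m / s + c\<^sup>2 * s / (2 - m)"
  have "f t \<le> exp (?\<phi> t - ?\<phi> t0) * f t0"
  proof (rule gronwall_along[OF order_refl t, where \<phi>' = ?\<phi>'])
    show "abs_continuous_on {t0..t} f"
      unfolding f_def
      by (intro abs_continuous_on_add abs_continuous_on_mult abs_continuous_energy abs_continuous_solution order_refl
            abs_continuous_on_C1[of _ _ "\<lambda>s. \<kappa> / s\<^sup>2" "\<lambda>s. - 2 * \<kappa> / s^3"])
         (use t0 in \<open>auto intro!: derivative_eq_intros continuous_intros simp: field_simps eval_nat_numeral\<close>)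
    show "(?\<phi> has_real_derivative ?\<phi>' s) (at s within {t0..t})" if "s \<in> {t0..t}" for s
    proof (rule DERIV_add)
      show "((\<lambda>s. - m * ln s) has_real_derivative - m / s) (at s within {t0..t})"
        using that t0 by (auto intro!: derivative_eq_intros)
      have "((\<lambda>s. c\<^sup>2 * s\<^sup>2 / (2 * d)) has_real_derivative c\<^sup>2 * s / d) (at s within {t0..t})" if "d > 0" for d
        using that by (auto intro!: derivative_eq_intros simp: field_simps)
      from this[of "2 - m"] m2
      show "((\<lambda>s. c\<^sup>2 * s\<^sup>2 / (2 * (2 - m))) has_real_derivative c\<^sup>2 * s / (2 - m)) (at s within {t0..t})"
        by simp
    qed
    show "continuous_on {t0..t} ?\<phi>'"
      using t0 m2 by (auto intro!: continuous_intros)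
    fix s assume s: "s \<in> {t0..t}"
      and D2: "(y' has_real_derivative - (b s * y' s + c\<^sup>2 * y s)) (at s within {t0..t})"
    have spos: "s > 0" using s t0 by auto
    have D1: "(y has_real_derivative y' s) (at s within {t0..t})"
      using deriv_Icc[OF order_refl s] .
    let ?q = "y s / s"
    let ?D = "- 2 * b s * (y' s)\<^sup>2 + \<kappa> / s * (2 * ?q * y' s - 2 * ?q\<^sup>2)"
    have "((\<lambda>s. \<kappa> / s\<^sup>2) has_real_derivative - 2 * \<kappa> / s^3) (at s within {t0..t})"
      using spos by (auto intro!: derivative_eq_intros simp: field_simps eval_nat_numeral)
    from DERIV_add[OF energy_has_derivative[OF s _ D2] DERIV_mult'[OF this DERIV_mult'[OF D1 D1]]]
    have "(f has_real_derivative - 2 * b s * (y' s)\<^sup>2 + (\<kappa> / s\<^sup>2 * (y s * y' s + y' s * y s)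
        + - 2 * \<kappa> / s^3 * (y s * y s))) (at s within {t0..t})"
      unfolding f_def by auto
    also have "- 2 * b s * (y' s)\<^sup>2 + (\<kappa> / s\<^sup>2 * (y s * y' s + y' s * y s)
        + - 2 * \<kappa> / s^3 * (y s * y s)) = ?D"
      by (simp add: divide_inverse algebra_simps power2_eq_square power3_eq_cube)
    finally have "(f has_real_derivative ?D) (at s within {t0..t})" .
    moreover have "?D \<le> ?\<phi>' s * f s"
    proof -
      have bs: "m / s \<le> b s" using b_lower[of s] s by auto
      have "0 \<le> m / s * (y' s - (2 - m) * ?q)\<^sup>2" using m spos by simp
      moreover have "0 \<le> 2 * (b s - m / s) * (y' s)\<^sup>2" using bs by simp
      moreover have "0 \<le> c\<^sup>2 * s / (2 - m) * energy s"
        using m2 spos energy_nonneg[of s] by simp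
      moreover have "?\<phi>' s * f s - ?D =
          m / s * (y' s - (2 - m) * ?q)\<^sup>2 + 2 * (b s - m / s) * (y' s)\<^sup>2 + c\<^sup>2 * s / (2 - m) * energy s"
      proof -
        have "c\<^sup>2 * s / (2 - m) * (\<kappa> / s\<^sup>2 * (y s * y s)) = m / s * (c\<^sup>2 * (y s)\<^sup>2)"
          using m2 spos by (simp add: \<kappa>_def field_simps power2_eq_square)
        moreover have "\<kappa> / s\<^sup>2 * (y s * y s) = \<kappa> * ?q\<^sup>2"
          using spos by (simp add: field_simps power2_eq_square)
        ultimately show ?thesis
          unfolding f_def \<kappa>_def energy_def by (simp add: algebra_simps power2_eq_square add_divide_distrib diff_divide_distrib)
      qed
      ultimately show ?thesis by linarith
    qed
    ultimately show "\<exists>D\<le>?\<phi>' s * f s. (f has_real_derivative D) (at s within {t0..t})"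
      by blast
  qed
  also have "exp (?\<phi> t - ?\<phi> t0) \<le> exp (c\<^sup>2 * t\<^sup>2 / (2 * (2 - m))) * (t0 / t) powr m"
  proof -
    have "0 \<le> c\<^sup>2 * t0\<^sup>2 / (2 * (2 - m))" using m2 by simp
    moreover have "(t0 / t) powr m = exp (m * (ln t0 - ln t))"
      using t0 t by (simp add: powr_def ln_div)
    ultimately show ?thesis
      by (simp add: algebra_simps flip: exp_add)
  qed
  finally have "f t \<le> exp (c\<^sup>2 * t\<^sup>2 / (2 * (2 - m))) * (t0 / t) powr m * f t0"
    using \<kappa> energy_nonneg[of t0] by (simp add: f_def mult_right_mono)
  moreover have "energy t \<le> f t"
    using \<kappa> by (simp add: f_def)
  ultimately show ?thesis
    by (simp add: f_def \<kappa>_def power2_eq_square)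
qed

text \<open>Where the quadratic functional degenerates, a weighted sum \<open>\<bar>y\<bar> + k * t * \<bar>y'\<bar>\<close> takes its place,
  whatever the size of \<open>m\<close> and the variation of \<open>b\<close>: the growth \<open>\<bar>y'\<bar>\<close> of the first term is paid for by the damping
  of the second. It grows at most like \<open>t powr (1 - \<mu> / 2)\<close>, up to a factor that stays bounded while
  \<open>c * t\<close> does, and \<open>\<mu>\<close> times this sum dominates \<open>t\<close> times the square root of the energy there. The weight
  \<open>k = 2 / \<mu>\<close> is large for small \<open>\<mu>\<close>, so this bound serves for \<open>\<mu> \<ge> 1\<close>.\<close>

lemma energy_bound_inertial_general:
  assumes \<mu>: "0 < \<mu>" "\<mu> \<le> m" "\<mu> \<le> 2" and t: "t0 \<le> t" "c * t \<le> \<mu>"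
  shows "energy t \<le> 4 * exp (2 * \<mu>) * (t0 / t) powr \<mu> * (4 * (y' t0)\<^sup>2 + 2 / t0\<^sup>2 * (y t0)\<^sup>2)"
proof -
  have pos: "t > 0" using t t0 by simp
  \<comment> \<open>The coefficient of \<open>\<bar>y'\<bar>\<close> in the derivative is at most \<open>1 + k * (1 - \<mu>)\<close>; this weight makes it
    equal to the permitted \<open>k * (1 - \<mu> / 2)\<close>.\<close>
  define k where "k = 2 / \<mu>"
  have k: "k > 0" "k * \<mu> = 2" using \<mu> by (auto simp: k_def)
  define N where "N = (\<lambda>s. \<bar>y s\<bar> + k * s * \<bar>y' s\<bar>)"
  let ?\<phi> = "\<lambda>s. (1 - \<mu> / 2) * ln s + k * c\<^sup>2 * s\<^sup>2 / 2"
  let ?\<phi>' = "\<lambda>s. (1 - \<mu> / 2) / s + k * c\<^sup>2 * s"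
  have N_nonneg: "N s \<ge> 0" if "t0 \<le> s" for s
    using k that t0 by (simp add: N_def)
  have "N t \<le> exp (?\<phi> t - ?\<phi> t0) * N t0"
  proof (rule gronwall_along[OF order_refl t(1), where \<phi>' = ?\<phi>'])
    show "abs_continuous_on {t0..t} N"
      unfolding N_def
      by (intro abs_continuous_on_add abs_continuous_on_mult abs_continuous_on_abs abs_continuous_solution abs_continuous_deriv order_refl
            abs_continuous_on_ident abs_continuous_on_C1[of _ _ "\<lambda>s. k" "\<lambda>s. 0"])
         auto
    show "(?\<phi> has_real_derivative ?\<phi>' s) (at s within {t0..t})" if "s \<in> {t0..t}" for s
      using that t0 by (auto intro!: derivative_eq_intros simp: field_simps)
    show "continuous_on {t0..t} ?\<phi>'"
      using t0 by (auto intro!: continuous_intros)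
    fix s assume s: "s \<in> {t0..t}"
      and D2: "(y' has_real_derivative - (b s * y' s + c\<^sup>2 * y s)) (at s within {t0..t})"
      and abs_deriv: "\<And>g g'. g \<in> {y, y'} \<Longrightarrow> (g has_real_derivative g') (at s within {t0..t}) \<Longrightarrow>
         ((\<lambda>x. \<bar>g x\<bar>) has_real_derivative sgn (g s) * g') (at s within {t0..t})"
    have spos: "s > 0" using s t0 by auto
    have D1: "(y has_real_derivative y' s) (at s within {t0..t})"
      using deriv_Icc[OF order_refl s] .
    let ?D = "sgn (y s) * y' s + (k * \<bar>y' s\<bar> + k * s * (sgn (y' s) * (- (b s * y' s + c\<^sup>2 * y s))))"
    have "(N has_real_derivative ?D) (at s within {t0..t})"
      unfolding N_def
      by (rule derivative_eq_intros abs_deriv[OF _ D1] abs_deriv[OF _ D2] refl | simp)+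
    moreover have "?D \<le> ?\<phi>' s * N s"
    proof -
      have sgn_le: "sgn p * q \<le> \<bar>q\<bar>" for p q :: real
        by (auto simp: sgn_if)
      have bs: "m \<le> s * b s" using b_lower[of s] s spos by (simp add: field_simps)
      have "k * s * (sgn (y' s) * (- (b s * y' s + c\<^sup>2 * y s)))
          = - (k * (s * b s) * \<bar>y' s\<bar>) + k * s * (sgn (y' s) * (- (c\<^sup>2 * y s)))"
        by (simp add: algebra_simps abs_sgn)
      also have "\<dots> \<le> - (k * \<mu> * \<bar>y' s\<bar>) + k * s * (c\<^sup>2 * \<bar>y s\<bar>)"
        using k bs \<mu>(2) spos sgn_le[of "y' s" "- (c\<^sup>2 * y s)"]
        by (intro add_mono mult_left_mono le_imp_neg_le mult_right_mono) (auto simp: abs_mult)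
      finally have "?D \<le> \<bar>y' s\<bar> + (k * \<bar>y' s\<bar> + (- (2 * \<bar>y' s\<bar>) + k * s * (c\<^sup>2 * \<bar>y s\<bar>)))"
        using sgn_le[of "y s" "y' s"] by (simp only: k(2) add_mono add_left_mono)
      also have "\<dots> \<le> ?\<phi>' s * N s"
      proof -
        have "?\<phi>' s * N s = (1 - \<mu> / 2) / s * \<bar>y s\<bar> + k * c\<^sup>2 * s * \<bar>y s\<bar>
            + k * \<bar>y' s\<bar> - (k * \<mu>) / 2 * \<bar>y' s\<bar> + k * c\<^sup>2 * s * (k * s * \<bar>y' s\<bar>)"
          using spos by (simp add: N_def field_simps)
        moreover have "0 \<le> (1 - \<mu> / 2) / s * \<bar>y s\<bar>" "0 \<le> k * c\<^sup>2 * s * (k * s * \<bar>y' s\<bar>)"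
          using \<mu> spos k by auto
        ultimately show ?thesis unfolding k(2) by (simp add: algebra_simps)
      qed
      finally show ?thesis .
    qed
    ultimately show "\<exists>D\<le>?\<phi>' s * N s. (N has_real_derivative D) (at s within {t0..t})"
      by blast
  qed
  also have "exp (?\<phi> t - ?\<phi> t0) \<le> exp \<mu> * (t / t0) powr (1 - \<mu> / 2)"
  proof -
    have "c\<^sup>2 * t\<^sup>2 \<le> \<mu>\<^sup>2"
      using t(2) c pos \<mu> power_mono[of "c * t" \<mu> 2] by (simp add: power_mult_distrib)
    then have "k * c\<^sup>2 * t\<^sup>2 / 2 \<le> k * \<mu>\<^sup>2 / 2"
      using k by (simp add: mult.assoc)
    also have "\<dots> = \<mu>" using k by (simp add: power2_eq_square flip: mult.assoc)
    finally have "k * c\<^sup>2 * t\<^sup>2 / 2 \<le> \<mu>" .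
    moreover have "0 \<le> k * c\<^sup>2 * t0\<^sup>2 / 2" using k by simp
    moreover have "(t / t0) powr (1 - \<mu> / 2) = exp ((1 - \<mu> / 2) * (ln t - ln t0))"
      using t0 pos by (simp add: powr_def ln_div)
    ultimately show ?thesis
      by (simp add: algebra_simps add_divide_distrib diff_divide_distrib flip: exp_add)
  qed
  finally have Nt: "N t \<le> exp \<mu> * (t / t0) powr (1 - \<mu> / 2) * N t0"
    using N_nonneg[of t0] by (simp add: mult_right_mono)
  have "energy t \<le> (c * \<bar>y t\<bar> + \<bar>y' t\<bar>)\<^sup>2"
    using c by (simp add: energy_def power2_sum power_mult_distrib)
  also have "\<dots> \<le> (\<mu> / t * N t)\<^sup>2"
  proof (rule power_mono)
    have "c * \<bar>y t\<bar> \<le> \<mu> / t * \<bar>y t\<bar>"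
      using t(2) pos by (intro mult_right_mono) (auto simp: field_simps)
    moreover have "\<bar>y' t\<bar> \<le> \<mu> / t * (k * t * \<bar>y' t\<bar>)"
    proof -
      have "\<mu> / t * (k * t * \<bar>y' t\<bar>) = k * \<mu> * \<bar>y' t\<bar>" using pos by simp
      then show ?thesis unfolding k(2) by simp
    qed
    ultimately show "c * \<bar>y t\<bar> + \<bar>y' t\<bar> \<le> \<mu> / t * N t"
      unfolding N_def distrib_left by (rule add_mono)
  qed (use c in simp)
  also have "\<dots> \<le> (\<mu> / t * (exp \<mu> * (t / t0) powr (1 - \<mu> / 2) * N t0))\<^sup>2"
    using Nt N_nonneg[OF t(1)] \<mu> pos by (intro power_mono mult_left_mono) auto
  also have "\<dots> = exp (2 * \<mu>) * (t0 / t) powr \<mu> * (\<mu> * (N t0 / t0))\<^sup>2"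
  proof -
    have "((t / t0) powr (1 - \<mu> / 2))\<^sup>2 = (t / t0) powr (2 - \<mu>)"
      by (simp add: power2_eq_square flip: powr_add)
    also have "\<dots> = (t / t0)\<^sup>2 * (t0 / t) powr \<mu>"
      using pos t0 powr_minus_divide[of "t / t0" \<mu>] by (simp add: powr_diff powr_divide power_divide)
    finally have *: "((t / t0) powr (1 - \<mu> / 2))\<^sup>2 = (t / t0)\<^sup>2 * (t0 / t) powr \<mu>" .
    have "exp \<mu> ^ 2 = exp (2 * \<mu>)" by (simp add: exp_double)
    then show ?thesis
      unfolding power_mult_distrib * using pos t0 by (simp add: field_simps)
  qed
  also have "\<dots> \<le> exp (2 * \<mu>) * (t0 / t) powr \<mu> * (4 * (4 * (y' t0)\<^sup>2 + 2 / t0\<^sup>2 * (y t0)\<^sup>2))"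
  proof (rule mult_left_mono)
    have "\<mu> * (N t0 / t0) = \<mu> * (\<bar>y t0\<bar> / t0) + 2 * \<bar>y' t0\<bar>"
    proof -
      have "\<mu> * (N t0 / t0) = \<mu> * (\<bar>y t0\<bar> / t0) + k * \<mu> * \<bar>y' t0\<bar>"
        using t0 by (simp add: N_def field_simps)
      then show ?thesis unfolding k(2) .
    qed
    also have "\<dots> \<le> 2 * (\<bar>y t0\<bar> / t0) + 2 * \<bar>y' t0\<bar>"
      using \<mu> t0 by (intro add_mono mult_right_mono) auto
    finally have "(\<mu> * (N t0 / t0))\<^sup>2 \<le> (2 * (\<bar>y t0\<bar> / t0) + 2 * \<bar>y' t0\<bar>)\<^sup>2"
      using \<mu> t0 N_nonneg[of t0] by (intro power_mono) auto
    also have "\<dots> \<le> 2 * (2 * (\<bar>y t0\<bar> / t0))\<^sup>2 + 2 * (2 * \<bar>y' t0\<bar>)\<^sup>2"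
      using zero_le_power2[of "2 * (\<bar>y t0\<bar> / t0) - 2 * \<bar>y' t0\<bar>"] by (simp add: power2_sum power2_diff)
    also have "\<dots> \<le> 4 * (4 * (y' t0)\<^sup>2 + 2 / t0\<^sup>2 * (y t0)\<^sup>2)"
      by (simp add: power_mult_distrib power_divide)
    finally show "(\<mu> * (N t0 / t0))\<^sup>2 \<le> 4 * (4 * (y' t0)\<^sup>2 + 2 / t0\<^sup>2 * (y t0)\<^sup>2)" .
  qed simp
  finally show ?thesis
    by (simp only: mult_ac)
qed

text \<open>Frequencies reach the oscillating regime at time \<open>K / c\<close>, or are in it from the start. At the time of
  the transition the bound from the first regime becomes the initial value for the second, and the
  powers of \<open>t\<close> multiply up.\<close>

lemma energy_decay_from_inertial_bound:
  assumes \<mu>: "0 < \<mu>" "\<mu> \<le> m" "\<mu> \<le> K"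
    and low: "\<And>s. t0 \<le> s \<Longrightarrow> c * s \<le> K \<Longrightarrow> energy s \<le> Q * (t0 / s) powr \<mu>"
    and init: "energy t0 \<le> Q" and t: "t0 \<le> t"
  shows "energy t \<le> exp (\<mu> * (2 * M + 5) / (2 * K)) * Q * (t0 / t) powr \<mu>"
proof -
  have Q: "Q \<ge> 0" using init energy_nonneg[of t0] by simp
  have e: "0 \<le> \<mu> * (2 * M + 5) / (2 * K)" using \<mu> m_le_M by simp
  show ?thesis
  proof (cases "c * t \<le> K")
    case True
    have "energy t \<le> 1 * (Q * (t0 / t) powr \<mu>)"
      using low[OF t True] by simp
    also have "\<dots> \<le> exp (\<mu> * (2 * M + 5) / (2 * K)) * (Q * (t0 / t) powr \<mu>)"
      using e Q by (intro mult_right_mono) auto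
    finally show ?thesis by (simp add: mult.assoc)
  next
    case False
    then have c: "c > 0" using c \<mu> by (cases "c = 0") auto
    define T where "T = max t0 (K / c)"
    have T: "t0 \<le> T" "K \<le> c * T" "T \<le> t"
      using False c t by (auto simp: T_def field_simps max_def)
    have ET: "energy T \<le> Q * (t0 / T) powr \<mu>"
    proof (cases "t0 \<le> K / c")
      case True
      then have "c * T \<le> K" using c by (simp add: T_def)
      then show ?thesis using low T(1) by blast
    next
      case False
      then have "T = t0" by (simp add: T_def)
      then show ?thesis using init t0 by simp
    qed
    have "energy t \<le> exp (\<mu> * (2 * M + 5) / (2 * (c * T))) * (T / t) powr \<mu> * energy T"
      using energy_decay_oscillating[of \<mu> T t] \<mu> T by auto
    also have "\<dots> \<le> exp (\<mu> * (2 * M + 5) / (2 * K)) * (T / t) powr \<mu> * (Q * (t0 / T) powr \<mu>)"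
    proof (intro mult_mono)
      show "exp (\<mu> * (2 * M + 5) / (2 * (c * T))) \<le> exp (\<mu> * (2 * M + 5) / (2 * K))"
        using T \<mu> m_le_M by (auto intro!: frac_le)
    qed (use ET energy_nonneg[of T] in auto)
    also have "\<dots> = exp (\<mu> * (2 * M + 5) / (2 * K)) * Q * ((T / t) * (t0 / T)) powr \<mu>"
      using t0 T by (subst powr_mult) auto
    also have "(T / t) * (t0 / T) = t0 / t" using t0 T by simp
    finally show ?thesis .
  qed
qed

text \<open>For \<open>m \<le> 1\<close> the transition is placed at \<open>c * t = 1\<close>; the exponents \<open>11 / 2 * m\<close> and
  \<open>m * (M + 5 / 2)\<close> from the two regimes add up to \<open>m * (M + 8)\<close>. Both vanish with \<open>m\<close>, as they must: for
  small \<open>m\<close> the numerical factors of the initial data are all that is left to absorb the constants.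
  For \<open>m \<ge> 1\<close> the transition is placed at \<open>c * t = \<mu>\<close>, and \<open>exp (m * (M + 8))\<close> is so large that
  absolute constants do not matter.\<close>

lemma energy_decay:
  assumes t: "t0 \<le> t"
  shows "energy t \<le> exp (m * (M + 8)) *
           (4 * (y' t0)\<^sup>2 + c\<^sup>2 * (y t0)\<^sup>2 + 2 / t0\<^sup>2 * (y t0)\<^sup>2) * (t0 / t) powr min m 2"
proof -
  define Q where "Q = 4 * (y' t0)\<^sup>2 + c\<^sup>2 * (y t0)\<^sup>2 + 2 / t0\<^sup>2 * (y t0)\<^sup>2"
  have Q: "energy t0 \<le> Q" "0 \<le> Q" by (auto simp: Q_def energy_def)
  show ?thesis
  proof (cases "m \<le> 1")
    case True
    have low: "energy s \<le> exp (11 / 2 * m) * Q * (t0 / s) powr m" if s: "t0 \<le> s" "c * s \<le> 1" for s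
    proof -
      have cs: "c\<^sup>2 * s\<^sup>2 \<le> 1" "c\<^sup>2 * t0\<^sup>2 \<le> 1"
        using power_mono[of "c * s" 1 2] power_mono[of "c * t0" 1 2] s c t0
          mult_left_mono[OF s(1) c] by (auto simp: power_mult_distrib)
      have "c\<^sup>2 * s\<^sup>2 / (2 * (2 - m)) \<le> 1 / 2"
        using True cs by (intro frac_le) auto
      then have "exp (c\<^sup>2 * s\<^sup>2 / (2 * (2 - m))) \<le> exp (1 / 2)" by simp
      then have e2: "exp (c\<^sup>2 * s\<^sup>2 / (2 * (2 - m))) \<le> 2"
        using exp_half_le2 by linarith
      \<comment> \<open>The factor \<open>2\<close> fits: it is half of the factor \<open>4\<close> of \<open>y'\<close>, and since \<open>c * t0 \<le> 1\<close> the excess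
        \<open>c\<^sup>2 * y\<^sup>2\<close> fits into \<open>2 / t0\<^sup>2 * y\<^sup>2\<close>.\<close>
      have "2 * (energy t0 + m * (2 - m) * (y t0)\<^sup>2 / t0\<^sup>2) \<le> (1 + 2 * m) * Q"
      proof -
        let ?r = "(y t0)\<^sup>2 / t0\<^sup>2"
        have "(c\<^sup>2 * t0\<^sup>2) * ?r \<le> 1 * ?r" using cs(2) by (intro mult_right_mono) auto
        then have cr: "c\<^sup>2 * (y t0)\<^sup>2 \<le> ?r" using t0 by simp
        have r0: "0 \<le> ?r" by simp
        have Q': "Q = 4 * (y' t0)\<^sup>2 + c\<^sup>2 * (y t0)\<^sup>2 + 2 * ?r" by (simp add: Q_def)
        have mr: "m * (2 - m) * (y t0)\<^sup>2 / t0\<^sup>2 \<le> 2 * (m * ?r)"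
          using m by (simp add: algebra_simps divide_right_mono)
        have "2 * (m * ?r) \<le> m * Q"
          using m unfolding Q' by (simp add: algebra_simps)
        moreover have "(1 + 2 * m) * Q = Q + 2 * (m * Q)" by (simp add: algebra_simps)
        moreover have "2 * energy t0 \<le> Q"
          using cr r0 zero_le_power2[of "y' t0"] unfolding Q' energy_def distrib_left by linarith
        moreover have "2 * (m * (2 - m) * (y t0)\<^sup>2 / t0\<^sup>2) \<le> 2 * (2 * (m * ?r))"
          using mr by (rule mult_left_mono) simp
        ultimately have "2 * energy t0 + 2 * (m * (2 - m) * (y t0)\<^sup>2 / t0\<^sup>2) \<le> (1 + 2 * m) * Q"
          by linarith
        then show ?thesis unfolding distrib_left[of 2 "energy t0"] .
      qed
      also have "\<dots> \<le> exp (11 / 2 * m) * Q"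
        using m Q exp_ge_add_one_self[of "11 / 2 * m"] by (intro mult_right_mono) linarith+
      finally have *: "2 * (energy t0 + m * (2 - m) * (y t0)\<^sup>2 / t0\<^sup>2) \<le> exp (11 / 2 * m) * Q" .
      have "energy s \<le> exp (c\<^sup>2 * s\<^sup>2 / (2 * (2 - m))) * (t0 / s) powr m *
           (energy t0 + m * (2 - m) * (y t0)\<^sup>2 / t0\<^sup>2)"
        using energy_bound_inertial_small_damping[of s] True s by simp
      also have "\<dots> \<le> 2 * (t0 / s) powr m * (energy t0 + m * (2 - m) * (y t0)\<^sup>2 / t0\<^sup>2)"
        using e2 m True energy_nonneg[of t0] by (intro mult_right_mono) auto
      also have "\<dots> \<le> exp (11 / 2 * m) * Q * (t0 / s) powr m"
        using mult_right_mono[OF *, of "(t0 / s) powr m"] by (simp only: mult_ac) simp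
      finally show ?thesis .
    qed
    have "energy t0 \<le> exp (11 / 2 * m) * Q"
      using Q m mult_right_mono[of 1 "exp (11 / 2 * m)" Q] by simp
    then have "energy t \<le> exp (m * (2 * M + 5) / (2 * 1)) * (exp (11 / 2 * m) * Q) * (t0 / t) powr m"
      using energy_decay_from_inertial_bound[of m 1 "exp (11 / 2 * m) * Q" t] low m True t by simp
    also have "\<dots> = exp (m * (M + 8)) * Q * (t0 / t) powr min m 2"
      using True by (simp add: algebra_simps add_divide_distrib flip: exp_add)
    finally show ?thesis unfolding Q_def .
  next
    case False
    define \<mu> where "\<mu> = min m 2"
    have \<mu>: "1 \<le> \<mu>" "\<mu> \<le> m" "\<mu> \<le> 2" using False by (auto simp: \<mu>_def)
    have low: "energy s \<le> 4 * exp (2 * \<mu>) * Q * (t0 / s) powr \<mu>" if s: "t0 \<le> s" "c * s \<le> \<mu>" for s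
    proof -
      have "energy s \<le> 4 * exp (2 * \<mu>) * (t0 / s) powr \<mu> * (4 * (y' t0)\<^sup>2 + 2 / t0\<^sup>2 * (y t0)\<^sup>2)"
        using energy_bound_inertial_general[of \<mu> s] \<mu> s by simp
      also have "\<dots> \<le> 4 * exp (2 * \<mu>) * (t0 / s) powr \<mu> * Q"
        by (intro mult_left_mono) (auto simp: Q_def)
      finally show ?thesis by (simp add: mult_ac)
    qed
    have "1 \<le> 4 * exp (2 * \<mu>)" using one_le_exp_iff[of "2 * \<mu>"] \<mu> by linarith
    then have "energy t0 \<le> 4 * exp (2 * \<mu>) * Q"
      using Q mult_right_mono[of 1 "4 * exp (2 * \<mu>)" Q] by linarith
    then have "energy t \<le> exp (\<mu> * (2 * M + 5) / (2 * \<mu>)) * (4 * exp (2 * \<mu>) * Q) * (t0 / t) powr \<mu>"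
      using energy_decay_from_inertial_bound[of \<mu> \<mu> "4 * exp (2 * \<mu>) * Q" t] low \<mu> t by simp
    also have "\<dots> = exp (M + 5 / 2) * 4 * exp (2 * \<mu>) * (Q * (t0 / t) powr \<mu>)"
      using \<mu> by (simp add: add_divide_distrib)
    also have "\<dots> \<le> exp (m * (M + 8)) * (Q * (t0 / t) powr \<mu>)"
    proof (rule mult_right_mono)
      have "(4::real) \<le> exp 2"
        using power_mono[OF exp_ge_add_one_self[of "1::real"], of 2] by (simp add: exp_double[symmetric])
      then have "exp (M + 5 / 2) * 4 * exp (2 * \<mu>) \<le> exp (M + 5 / 2) * exp 2 * exp (2 * \<mu>)"
        by simp
      also have "\<dots> = exp (M + 5 / 2 + 2 + 2 * \<mu>)" by (simp only: exp_add)
      also have "\<dots> \<le> exp (m * (M + 8))"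
      proof -
        have "1 * M \<le> m * M" using False m_le_M m by (intro mult_right_mono) auto
        then show ?thesis using False \<mu> by (simp add: distrib_left)
      qed
      finally show "exp (M + 5 / 2) * 4 * exp (2 * \<mu>) \<le> exp (m * (M + 8))" .
    qed (use Q in simp)
    finally show ?thesis unfolding Q_def \<mu>_def by (simp add: mult.assoc)
  qed
qed

end

section \<open>Passage to the Hilbert space\<close>

lemma L2_isometryD:
  assumes "L2_isometry \<nu> F"
  shows "F u \<in> borel_measurable \<nu>" "integrable \<nu> (\<lambda>\<xi>. (F u \<xi>)\<^sup>2)"
    "(LINT \<xi>|\<nu>. (F u \<xi>)\<^sup>2) = (norm u)\<^sup>2"
  using assms by (auto simp: L2_isometry_def square_integrable_def)

lemma L2_isometry_scaled_diff:
  assumes "L2_isometry \<nu> F"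
  shows "AE \<xi> in \<nu>. F (a *\<^sub>R (u - v)) \<xi> = a * (F u \<xi> - F v \<xi>)"
proof -
  have add: "\<And>u v. AE \<xi> in \<nu>. F (u + v) \<xi> = F u \<xi> + F v \<xi>"
    and scale: "\<And>c u. AE \<xi> in \<nu>. F (c *\<^sub>R u) \<xi> = c * F u \<xi>"
    using assms unfolding L2_isometry_def by blast+
  have "AE \<xi> in \<nu>. F (a *\<^sub>R u + (- a) *\<^sub>R v) \<xi> = a * (F u \<xi> - F v \<xi>)"
    using add[of "a *\<^sub>R u" "(- a) *\<^sub>R v"] scale[of a u] scale[of "- a" v]
    by eventually_elim (simp add: algebra_simps)
  then show ?thesis by (simp add: algebra_simps)
qed

lemma L2_isometry_diff:
  assumes "L2_isometry \<nu> F"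
  shows "AE \<xi> in \<nu>. F (u - v) \<xi> = F u \<xi> - F v \<xi>"
  using L2_isometry_scaled_diff[OF assms, of 1 u v] by simp

text \<open>Dominated convergence, read in the Hilbert space.\<close>

lemma L2_isometry_tendsto:
  fixes F :: "'h::{real_inner,complete_space} \<Rightarrow> 'x \<Rightarrow> real"
  assumes F: "L2_isometry \<nu> F"
    and g: "integrable \<nu> g"
    and bound: "\<And>i. AE \<xi> in \<nu>. (F (p i) \<xi>)\<^sup>2 \<le> g \<xi>" "AE \<xi> in \<nu>. (F v \<xi>)\<^sup>2 \<le> g \<xi>"
    and lim: "AE \<xi> in \<nu>. (\<lambda>i. F (p i) \<xi>) \<longlonglongrightarrow> F v \<xi>"
  shows "p \<longlonglongrightarrow> v"
proof -
  have diff: "AE \<xi> in \<nu>. \<forall>i. F (p i - v) \<xi> = F (p i) \<xi> - F v \<xi>"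
    using L2_isometry_diff[OF F] by (simp add: AE_all_countable)
  have "(\<lambda>i. LINT \<xi>|\<nu>. (F (p i - v) \<xi>)\<^sup>2) \<longlonglongrightarrow> (LINT \<xi>|\<nu>. 0)"
  proof (rule integral_dominated_convergence[where w = "\<lambda>\<xi>. 4 * g \<xi>"])
    show "AE \<xi> in \<nu>. (\<lambda>i. (F (p i - v) \<xi>)\<^sup>2) \<longlonglongrightarrow> 0"
      using diff lim
    proof eventually_elim
      case (elim \<xi>)
      have "(\<lambda>i. (F (p i) \<xi> - F v \<xi>)\<^sup>2) \<longlonglongrightarrow> (F v \<xi> - F v \<xi>)\<^sup>2"
        by (intro tendsto_intros elim)
      then show ?case using elim by simp
    qed
    show "AE \<xi> in \<nu>. norm ((F (p i - v) \<xi>)\<^sup>2) \<le> 4 * g \<xi>" for i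
      using diff bound(1)[of i] bound(2)
    proof eventually_elim
      case (elim \<xi>)
      have "(F (p i) \<xi> - F v \<xi>)\<^sup>2 \<le> 2 * (F (p i) \<xi>)\<^sup>2 + 2 * (F v \<xi>)\<^sup>2"
        using zero_le_power2[of "F (p i) \<xi> + F v \<xi>"] by (simp add: power2_sum power2_diff)
      then show ?case using elim by simp
    qed
  qed (use g L2_isometryD[OF F] in auto)
  then have "(\<lambda>i. (norm (p i - v))\<^sup>2) \<longlonglongrightarrow> 0"
    by (simp add: L2_isometryD(3)[OF F])
  then have "(\<lambda>i. norm (p i - v)) \<longlonglongrightarrow> 0"
    using tendsto_real_sqrt[of "\<lambda>i. (norm (p i - v))\<^sup>2" 0 sequentially] by simp
  then show ?thesis
    by (rule LIM_zero_cancel[OF tendsto_norm_zero_cancel])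
qed

lemma has_vector_derivative_sequentially:
  fixes u :: "real \<Rightarrow> 'h::real_normed_vector"
  assumes "\<And>X. (\<And>i. X i \<in> S - {t}) \<Longrightarrow> X \<longlonglongrightarrow> t \<Longrightarrow>
    (\<lambda>i. (1 / (X i - t)) *\<^sub>R (u (X i) - u t)) \<longlonglongrightarrow> v"
  shows "(u has_vector_derivative v) (at t within S)"
proof -
  have "((\<lambda>s. (1 / (s - t)) *\<^sub>R (u s - u t)) \<longlongrightarrow> v) (at t within S)"
    using assms by (auto simp: tendsto_at_iff_sequentially comp_def)
  then have "((\<lambda>s. norm ((1 / (s - t)) *\<^sub>R (u s - u t) - v)) \<longlongrightarrow> 0) (at t within S)"
    by (rule tendsto_norm_zero[OF LIM_zero])
  then have "((\<lambda>s. norm ((u s - u t - (s - t) *\<^sub>R v) /\<^sub>R norm (s - t))) \<longlongrightarrow> 0) (at t within S)"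
  proof (rule Lim_transform_eventually)
    show "\<forall>\<^sub>F s in at t within S. norm ((1 / (s - t)) *\<^sub>R (u s - u t) - v) =
        norm ((u s - u t - (s - t) *\<^sub>R v) /\<^sub>R norm (s - t))"
    proof (rule eventually_at_filter[THEN iffD2], rule always_eventually, intro allI impI)
      fix s assume "s \<noteq> t"
      then have "(1 / (s - t)) *\<^sub>R (u s - u t) - v = (1 / (s - t)) *\<^sub>R (u s - u t - (s - t) *\<^sub>R v)"
        by (simp add: scaleR_diff_right)
      then show "norm ((1 / (s - t)) *\<^sub>R (u s - u t) - v) =
        norm ((u s - u t - (s - t) *\<^sub>R v) /\<^sub>R norm (s - t))"
        by (simp add: divide_inverse_commute)
    qed
  qed
  then show ?thesis
    unfolding has_vector_derivative_def has_derivative_at_within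
    by (rule conjI[OF bounded_linear_scaleR_left tendsto_norm_zero_cancel])
qed

text \<open>A curve whose spectral representatives are differentiable, with a common square integrable bound
  for the derivatives, is differentiable in the Hilbert space: by the mean value theorem the
  difference quotients satisfy the same bound, so dominated convergence applies.\<close>

lemma L2_isometry_has_vector_derivative:
  fixes F :: "'h::{real_inner,complete_space} \<Rightarrow> 'x \<Rightarrow> real" and u :: "real \<Rightarrow> 'h"
  assumes F: "L2_isometry \<nu> F" and S: "convex S" "t \<in> S" "t islimpt S"
    and rep: "\<And>s. s \<in> S \<Longrightarrow> AE \<xi> in \<nu>. F (u s) \<xi> = w s \<xi>"
    and deriv: "\<And>s \<xi>. s \<in> S \<Longrightarrow> \<xi> \<in> space \<nu> \<Longrightarrow>
      ((\<lambda>s. w s \<xi>) has_real_derivative w' s \<xi>) (at s within S)"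
    and g: "integrable \<nu> g"
    and bound: "\<And>s \<xi>. s \<in> S \<Longrightarrow> \<xi> \<in> space \<nu> \<Longrightarrow> (w' s \<xi>)\<^sup>2 \<le> g \<xi>"
  obtains v where "(u has_vector_derivative v) (at t within S)" "AE \<xi> in \<nu>. F v \<xi> = w' t \<xi>"
proof -
  define p where "p s = (1 / (s - t)) *\<^sub>R (u s - u t)" for s
  have Fp: "AE \<xi> in \<nu>. F (p s) \<xi> = (w s \<xi> - w t \<xi>) / (s - t)" if "s \<in> S" for s
    using L2_isometry_scaled_diff[OF F, of "1 / (s - t)" "u s" "u t"] rep[OF that] rep[OF S(2)]
    by eventually_elim (simp add: p_def)
  have pbound: "AE \<xi> in \<nu>. (F (p s) \<xi>)\<^sup>2 \<le> g \<xi>" if s: "s \<in> S" for s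
    using Fp[OF s] AE_space
  proof eventually_elim
    case (elim \<xi>)
    have "g \<xi> \<ge> 0" using bound[OF s elim(2)] by (meson order_trans zero_le_power2)
    have "norm (w s \<xi> - w t \<xi>) \<le> sqrt (g \<xi>) * norm (s - t)"
    proof (rule field_differentiable_bound[OF S(1) _ _ s S(2), where f' = "\<lambda>s. w' s \<xi>"])
      fix z assume z: "z \<in> S"
      show "((\<lambda>s. w s \<xi>) has_real_derivative w' z \<xi>) (at z within S)"
        by (rule deriv[OF z elim(2)])
      show "norm (w' z \<xi>) \<le> sqrt (g \<xi>)"
        using bound[OF z elim(2)] by (intro real_le_rsqrt) simp
    qed
    then have "(w s \<xi> - w t \<xi>)\<^sup>2 \<le> g \<xi> * (s - t)\<^sup>2"
      using power_mono[of "\<bar>w s \<xi> - w t \<xi>\<bar>" "sqrt (g \<xi>) * \<bar>s - t\<bar>" 2] \<open>g \<xi> \<ge> 0\<close>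
      by (simp add: power_mult_distrib)
    then show ?case
      using \<open>g \<xi> \<ge> 0\<close> unfolding elim(1) power_divide by (cases "s = t") (auto simp: pos_divide_le_eq)
  qed
  have plim: "AE \<xi> in \<nu>. (\<lambda>i. F (p (X i)) \<xi>) \<longlonglongrightarrow> w' t \<xi>"
    if X: "\<And>i. X i \<in> S - {t}" "X \<longlonglongrightarrow> t" for X
  proof -
    have "AE \<xi> in \<nu>. \<forall>i. F (p (X i)) \<xi> = (w (X i) \<xi> - w t \<xi>) / (X i - t)"
      using Fp X(1) by (simp add: AE_all_countable)
    then show ?thesis
      using AE_space
    proof eventually_elim
      case (elim \<xi>)
      have "((\<lambda>s. (w s \<xi> - w t \<xi>) / (s - t)) \<longlongrightarrow> w' t \<xi>) (at t within S)"
        using deriv[OF S(2) elim(2)] by (simp add: has_field_derivative_iff)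
      then show ?case
        using X elim(1) by (auto simp: tendsto_at_iff_sequentially comp_def)
    qed
  qed
  obtain X where X: "\<And>i::nat. X i \<in> S - {t}" "X \<longlonglongrightarrow> t"
    using S(3) by (auto simp: islimpt_sequential)
  \<comment> \<open>The function \<open>w' t\<close> itself may fail to be measurable, because \<open>w s\<close> is only almost everywhere equal
    to a measurable function. The limit of the difference quotients of \<open>F (u s)\<close> is measurable
    everywhere and agrees with it almost everywhere.\<close>
  define h where "h \<xi> = lim (\<lambda>i. F (p (X i)) \<xi>)" for \<xi>
  have h: "AE \<xi> in \<nu>. h \<xi> = w' t \<xi>"
    using plim[OF X] by eventually_elim (simp add: h_def limI)
  have hm: "h \<in> borel_measurable \<nu>"
    unfolding h_def by (intro borel_measurable_lim_metric L2_isometryD(1)[OF F])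
  have hb: "AE \<xi> in \<nu>. (h \<xi>)\<^sup>2 \<le> g \<xi>"
    using h AE_space by eventually_elim (simp add: bound S(2))
  have "integrable \<nu> (\<lambda>\<xi>. (h \<xi>)\<^sup>2)"
    by (rule Bochner_Integration.integrable_bound[OF g]) (use hm hb in auto)
  with hm have "h \<in> square_integrable \<nu>" by (simp add: square_integrable_def)
  then obtain v where v: "AE \<xi> in \<nu>. F v \<xi> = h \<xi>"
    using F unfolding L2_isometry_def by blast
  have v': "AE \<xi> in \<nu>. F v \<xi> = w' t \<xi>"
    using v h by eventually_elim simp
  have "(u has_vector_derivative v) (at t within S)"
  proof (rule has_vector_derivative_sequentially)
    fix X assume X: "\<And>i. X i \<in> S - {t}" "X \<longlonglongrightarrow> t"
    have "(\<lambda>i. p (X i)) \<longlonglongrightarrow> v"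
    proof (rule L2_isometry_tendsto[OF F g])
      show "AE \<xi> in \<nu>. (F (p (X i)) \<xi>)\<^sup>2 \<le> g \<xi>" for i
        using pbound X(1) by blast
      show "AE \<xi> in \<nu>. (F v \<xi>)\<^sup>2 \<le> g \<xi>"
        using v hb by eventually_elim simp
      show "AE \<xi> in \<nu>. (\<lambda>i. F (p (X i)) \<xi>) \<longlonglongrightarrow> F v \<xi>"
        using plim[OF X] v' by eventually_elim simp
    qed
    then show "(\<lambda>i. (1 / (X i - t)) *\<^sub>R (u (X i) - u t)) \<longlonglongrightarrow> v"
      by (simp add: p_def)
  qed
  then show thesis using v' that by blast
qed

lemma scalar_solution_energy_decay:
  assumes "t0 > 0" "m > 0" "c \<ge> 0" "\<forall>t\<ge>t0. m / t \<le> b t \<and> b t \<le> M / t"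
    and "scalar_solution t0 b c y0 y1 y"
  obtains y' where
    "\<And>t. t \<ge> t0 \<Longrightarrow> (y has_real_derivative y' t) (at t within {t0..})"
    "\<And>t. t \<ge> t0 \<Longrightarrow> (y' t)\<^sup>2 + c\<^sup>2 * (y t)\<^sup>2 \<le>
       exp (m * (M + 8)) * (4 * y1\<^sup>2 + c\<^sup>2 * y0\<^sup>2 + 2 / t0\<^sup>2 * y0\<^sup>2) * (t0 / t) powr min m 2"
proof -
  obtain y' where y': "\<forall>t\<ge>t0. (y has_real_derivative y' t) (at t within {t0..})"
    "\<forall>T>t0. abs_continuous_on {t0..T} y'"
    "AE t in lebesgue. t0 \<le> t \<longrightarrow> (\<exists>y''. (y' has_real_derivative y'') (at t within {t0..}) \<and>
       y'' + b t * y' t + c\<^sup>2 * y t = 0)"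
    "y t0 = y0" "y' t0 = y1"
    using assms(5) unfolding scalar_solution_def by blast
  have "AE t in lebesgue. t0 \<le> t \<longrightarrow>
      (y' has_real_derivative - (b t * y' t + c\<^sup>2 * y t)) (at t within {t0..})"
    using y'(3)
  proof eventually_elim
    case (elim t)
    show ?case
    proof
      assume "t0 \<le> t"
      then obtain y'' where "(y' has_real_derivative y'') (at t within {t0..})"
        "y'' + b t * y' t + c\<^sup>2 * y t = 0"
        using elim by blast
      moreover from this(2) have "y'' = - (b t * y' t + c\<^sup>2 * y t)" by simp
      ultimately show "(y' has_real_derivative - (b t * y' t + c\<^sup>2 * y t)) (at t within {t0..})"
        by simp
    qed
  qed
  then interpret damped_oscillator t0 m M c b y y'
    using assms y'(1,2) by unfold_locales auto
  show thesis
    using that[of y'] y'(1) energy_decay unfolding energy_def y'(4,5) by blast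
qed

theorem theorem2p1:
  fixes \<nu> :: "'x measure" and l :: "'x \<Rightarrow> real"
    and F :: "'h::{real_inner,complete_space} \<Rightarrow> 'x \<Rightarrow> real"
    and D :: "'h set" and A :: "'h \<Rightarrow> 'h"
    and t0 m M \<mu> :: real and b :: "real \<Rightarrow> real"
    and u0 u1 :: 'h and u :: "real \<Rightarrow> 'h"
  assumes "unitarily_multiplication \<nu> l F D A"
    and "t0 > 0"
    and "b \<in> borel_measurable (lebesgue_on {t0..})"
    and "M \<ge> m" and "m > 0"
    and "\<forall>t\<ge>t0. m / t \<le> b t \<and> b t \<le> M / t"
    and "\<mu> = min m 2"
    and "u0 \<in> power_domain \<nu> l F (1/2)"
    and "spectral_solution \<nu> l F t0 b u0 u1 u"
  shows "\<forall>t\<ge>t0.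
    (norm (vector_derivative u (at t within {t0..})))\<^sup>2 + (norm (power_operator \<nu> l F (1/2) (u t)))\<^sup>2
      \<le> exp (m * (M + 8)) *
         (4 * (norm u1)\<^sup>2 + (norm (power_operator \<nu> l F (1/2) u0))\<^sup>2 + 2 / t0\<^sup>2 * (norm u0)\<^sup>2) *
         (t0 / t) powr \<mu>"
proof (intro allI impI)
  fix t assume t: "t0 \<le> t"
  have F: "L2_isometry \<nu> F" and lm: "l \<in> borel_measurable \<nu>" and l0: "\<And>\<xi>. \<xi> \<in> space \<nu> \<Longrightarrow> 0 \<le> l \<xi>"
    using assms(1) by (auto simp: unitarily_multiplication_def)
  note Fm[measurable] = L2_isometryD(1)[OF F] and lm[measurable]
  have powr2: "l \<xi> powr (4 * (1/2)) = (l \<xi>)\<^sup>2" if "\<xi> \<in> space \<nu>" for \<xi>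
    using l0[OF that] by (cases "l \<xi> = 0") (auto simp: powr_numeral)
  have dom_iff: "x \<in> power_domain \<nu> l F (1/2) \<longleftrightarrow> integrable \<nu> (\<lambda>\<xi>. (l \<xi>)\<^sup>2 * (F x \<xi>)\<^sup>2)" for x
  proof -
    have "(\<integral>\<^sup>+ \<xi>. ennreal (l \<xi> powr (4 * (1/2)) * (F x \<xi>)\<^sup>2) \<partial>\<nu>) =
        (\<integral>\<^sup>+ \<xi>. ennreal (norm ((l \<xi>)\<^sup>2 * (F x \<xi>)\<^sup>2)) \<partial>\<nu>)"
      by (intro nn_integral_cong) (simp only: powr2, simp)
    then show ?thesis
      unfolding power_domain_def by (simp add: integrable_iff_bounded)
  qed
  have root_norm: "(norm (power_operator \<nu> l F (1/2) x))\<^sup>2 = (LINT \<xi>|\<nu>. (l \<xi>)\<^sup>2 * (F x \<xi>)\<^sup>2)"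
    if "x \<in> power_domain \<nu> l F (1/2)" for x
    unfolding power_operator_spectral(2)[OF F lm that]
    by (intro Bochner_Integration.integral_cong refl) (simp only: powr2)
  obtain w where w: "\<And>\<xi>. \<xi> \<in> space \<nu> \<Longrightarrow> scalar_solution t0 b (l \<xi>) (F u0 \<xi>) (F u1 \<xi>) (\<lambda>t. w t \<xi>)"
    and uw: "\<And>t. t \<ge> t0 \<Longrightarrow> AE \<xi> in \<nu>. F (u t) \<xi> = w t \<xi>"
    using assms(9) unfolding spectral_solution_def by blast
  define C where "C = exp (m * (M + 8))"
  define g where "g \<xi> = 4 * (F u1 \<xi>)\<^sup>2 + (l \<xi>)\<^sup>2 * (F u0 \<xi>)\<^sup>2 + 2 / t0\<^sup>2 * (F u0 \<xi>)\<^sup>2" for \<xi>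
  have g: "integrable \<nu> g" "g \<xi> \<ge> 0" for \<xi>
    unfolding g_def using assms(8) dom_iff L2_isometryD(2)[OF F] by auto
  have "\<exists>y'. \<forall>t\<ge>t0. ((\<lambda>t. w t \<xi>) has_real_derivative y' t) (at t within {t0..}) \<and>
      (y' t)\<^sup>2 + (l \<xi>)\<^sup>2 * (w t \<xi>)\<^sup>2 \<le> C * g \<xi> * (t0 / t) powr \<mu>" if \<xi>: "\<xi> \<in> space \<nu>" for \<xi>
    using scalar_solution_energy_decay[OF assms(2,5) l0[OF \<xi>] assms(6) w[OF \<xi>]]
    unfolding C_def g_def assms(7) by metis
  then obtain w0 where w0: "\<And>\<xi> t. \<xi> \<in> space \<nu> \<Longrightarrow> t \<ge> t0 \<Longrightarrow>
       ((\<lambda>t. w t \<xi>) has_real_derivative w0 \<xi> t) (at t within {t0..})"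
    and est: "\<And>\<xi> t. \<xi> \<in> space \<nu> \<Longrightarrow> t \<ge> t0 \<Longrightarrow>
       (w0 \<xi> t)\<^sup>2 + (l \<xi>)\<^sup>2 * (w t \<xi>)\<^sup>2 \<le> C * g \<xi> * (t0 / t) powr \<mu>"
    by metis
  \<comment> \<open>As \<open>(t0 / s) powr \<mu> \<le> 1\<close>, the decay estimate also provides the bound, uniform in time, under which
    the difference quotients converge.\<close>
  have dom: "(w0 \<xi> s)\<^sup>2 \<le> C * g \<xi>" if "\<xi> \<in> space \<nu>" "s \<ge> t0" for \<xi> s
  proof -
    have "(w0 \<xi> s)\<^sup>2 \<le> C * g \<xi> * (t0 / s) powr \<mu>"
      using est[OF that] by (smt (verit) mult_nonneg_nonneg zero_le_power2)
    also have "\<dots> \<le> C * g \<xi> * 1"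
      using g(2) that assms(2,5,7) by (intro mult_left_mono powr_le1) (auto simp: C_def)
    finally show ?thesis by simp
  qed
  have lim: "t islimpt {t0..}"
  proof (rule islimpt_subset)
    show "t islimpt {t..t + 1}" by (simp add: islimpt_Icc)
  qed (use t in auto)
  have "\<exists>v. (u has_vector_derivative v) (at t within {t0..}) \<and> (AE \<xi> in \<nu>. F v \<xi> = w0 \<xi> t)"
  proof (rule L2_isometry_has_vector_derivative[OF F, where S = "{t0..}" and t = t and u = u and w = w
        and w' = "\<lambda>s \<xi>. w0 \<xi> s" and g = "\<lambda>\<xi>. C * g \<xi>"])
    show "integrable \<nu> (\<lambda>\<xi>. C * g \<xi>)" using g by simp
    show "convex {t0..}" by (rule convex_real_interval)
    show "AE \<xi> in \<nu>. F (u s) \<xi> = w s \<xi>" if "s \<in> {t0..}" for s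
      using that by (intro uw) simp
    show "((\<lambda>s. w s \<xi>) has_real_derivative w0 \<xi> s) (at s within {t0..})"
      if "s \<in> {t0..}" "\<xi> \<in> space \<nu>" for s \<xi>
      using that by (intro w0) simp_all
    show "(w0 \<xi> s)\<^sup>2 \<le> C * g \<xi>" if "s \<in> {t0..}" "\<xi> \<in> space \<nu>" for s \<xi>
      using that by (intro dom) simp_all
    show "t \<in> {t0..}" using t by simp
  qed (fact lim, rule exI, rule conjI)
  then obtain v where v: "(u has_vector_derivative v) (at t within {t0..})" "AE \<xi> in \<nu>. F v \<xi> = w0 \<xi> t"
    by (elim exE conjE)
  have "at t within {t0..} \<noteq> bot"
    using lim by (simp add: trivial_limit_within)
  then have u': "vector_derivative u (at t within {t0..}) = v"
    using v(1) by (rule vector_derivative_within)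
  have ae: "AE \<xi> in \<nu>. (F v \<xi>)\<^sup>2 + (l \<xi>)\<^sup>2 * (F (u t) \<xi>)\<^sup>2 \<le> C * g \<xi> * (t0 / t) powr \<mu>"
    using v(2) uw[OF t] AE_space by eventually_elim (simp add: est t)
  have "integrable \<nu> (\<lambda>\<xi>. (l \<xi>)\<^sup>2 * (F (u t) \<xi>)\<^sup>2)"
  proof (rule Bochner_Integration.integrable_bound)
    show "integrable \<nu> (\<lambda>\<xi>. C * g \<xi> * (t0 / t) powr \<mu>)" using g by simp
    show "AE \<xi> in \<nu>. norm ((l \<xi>)\<^sup>2 * (F (u t) \<xi>)\<^sup>2) \<le> norm (C * g \<xi> * (t0 / t) powr \<mu>)"
      using ae by eventually_elim (smt (verit) mult_nonneg_nonneg real_norm_def zero_le_power2)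
  qed measurable
  then have ut: "u t \<in> power_domain \<nu> l F (1/2)" using dom_iff by simp
  have "(norm v)\<^sup>2 + (norm (power_operator \<nu> l F (1/2) (u t)))\<^sup>2
      = (LINT \<xi>|\<nu>. (F v \<xi>)\<^sup>2 + (l \<xi>)\<^sup>2 * (F (u t) \<xi>)\<^sup>2)"
    using L2_isometryD(2,3)[OF F] root_norm[OF ut] ut dom_iff by simp
  also have "\<dots> \<le> (LINT \<xi>|\<nu>. C * g \<xi> * (t0 / t) powr \<mu>)"
    using ut dom_iff L2_isometryD(2)[OF F] g ae by (intro integral_mono_AE) auto
  also have "\<dots> = C * (LINT \<xi>|\<nu>. g \<xi>) * (t0 / t) powr \<mu>"
    by simp
  also have "(LINT \<xi>|\<nu>. g \<xi>) = 4 * (norm u1)\<^sup>2 + (norm (power_operator \<nu> l F (1/2) u0))\<^sup>2 + 2 / t0\<^sup>2 * (norm u0)\<^sup>2"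
    unfolding g_def using L2_isometryD(2,3)[OF F] root_norm[OF assms(8)] assms(8) dom_iff by simp
  finally show "(norm (vector_derivative u (at t within {t0..})))\<^sup>2 + (norm (power_operator \<nu> l F (1/2) (u t)))\<^sup>2
      \<le> exp (m * (M + 8)) *
         (4 * (norm u1)\<^sup>2 + (norm (power_operator \<nu> l F (1/2) u0))\<^sup>2 + 2 / t0\<^sup>2 * (norm u0)\<^sup>2) *
         (t0 / t) powr \<mu>"
    unfolding u' C_def .
qed

end
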